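(* Let $\theta\ge 1$, $0<\alpha\le 1$, let $m\ge 1$ be an integer, and let $(G_n)_{n\ge1}$ be a sequence of random graphs following the linear de-preferential attachment model with parameters $\alpha$, $\theta$ and $m$. Let $v_i$ be a fixed vertex and let $d_i(n)$ be its degree in $G_n$. Then, as $n\to\infty$: 1. $\dfrac{d_i(n)}{m\log n}\xrightarrow{P}1$. 2. $\dfrac{d_i(n)-m\log n}{\sqrt{m\log n}}\xrightarrow{d}N(0,1)$. 3. If $m=1$, then for every $k\ge 1$, the probability that the vertex $v_{n+1}$ attaches to a vertex having degree $k$ in $G_n$ converges to $2^{-k}$; that is, $$P\big(e_{n+1}=\{v_{n+1},v_j\}\text{ for some } j\in\{1,\dots,n\}\text{ with } d_j(n)=k\big)\to \frac1{2^k}.$$ 4. If $m=1$, let $P_k(n)=\frac1n\sum_{j=1}^n \mathbf 1_{\{d_j(n)=k\}}$ be the fraction of vertices of degree $k$ in $G_n$ and let $p_k=2^{-k}$ for $k\ge1$. Then there exists a constant $C_1>0$ such that, as $n\to\infty$, $$P\left(\max_{k}|P_k(n)-p_k|>C_1\left(\frac{\log n}{n}+\sqrt{\frac{\log n}{n}}\right)\right)=o(1).$$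
   Context: Linear de-preferential attachment model with parameters $0<\alpha\le1$, $\theta\ge1$ and $m\ge1$. The graph $G_n$ has vertex set $\{v_1,\dots,v_n\}$. Initially there is a single vertex $v_1$ carrying $m$ half-edges, so $d_1(1)=m$. At each time $n\ge1$ a new vertex $v_{n+1}$ with $m$ half-edges $e_{n+1,1},\dots,e_{n+1,m}$ arrives. The half-edges are attached one after another to vertices among $v_1,\dots,v_n$, and degrees of existing vertices are updated after each attachment; the resulting graph is $G_{n+1}$. For $j=1,\dots,n$ and $k=0,\dots,m-1$, $d_j(n+1,k)$ is the degree (in-degree plus out-degree) of $v_j$ after $k$ half-edges of $v_{n+1}$ have been attached, and $\mathcal F_{n+1,k}$ is the natural filtration, i.e. the information available at that moment. The degree of $v_j$ in $G_n$ is $d_j(n)=d_j(n+1,0)$, and a newly completed vertex has $d_{n+1}(n+1)=m$. Conditionally on $\mathcal F_{n+1,k}$, the $(k+1)$-st half-edge $e_{n+1,k+1}$ is attached to $v_j$, $j=1,\dots,n$, with probability $$\frac{1}{n\theta-\alpha}\left(\theta-\frac{\alpha\, d_j(n+1,k)}{k+(2n-1)m}\right),$$ (for $n=1$ it is attached to $v_1$ with probability $1$). Here $k+(2n-1)m=\sum_{j=1}^n d_j(n+1,k)$. For $m=1$ the single half-edge of $v_{n+1}$ is denoted $e_{n+1}$, and the attachment probability is $\frac{1}{n\theta-\alpha}\big(\theta-\frac{\alpha d_j(n)}{2n-1}\big)$. *)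

theory Defs
  imports "HOL-Probability.Probability" "Graph_Theory.Digraph"
begin

text \<open>
  The vertex \<open>v\<^sub>j\<close> is the number \<open>j \<ge> 1\<close>, and the half-edge \<open>e\<^sub>r\<^sub>,\<^sub>l\<close> is the pair \<open>(r, l)\<close> with
  \<open>r \<ge> 2\<close> and \<open>1 \<le> l \<le> m\<close>. A realisation of the attachment process is a function \<open>t\<close> such that
  \<open>e\<^sub>r\<^sub>,\<^sub>l\<close> is attached to the vertex \<open>t r l\<close>. The graph \<open>G\<^sub>n\<close> is a multigraph, its edges being oriented
  from the newer to the older vertex. The \<open>m\<close> half-edges of \<open>v\<^sub>1\<close> are never attached, so they are not
  arcs of \<open>G\<^sub>n\<close>.
\<close>

definition dpa_graph :: "nat \<Rightarrow> (nat \<Rightarrow> nat \<Rightarrow> nat) \<Rightarrow> nat \<Rightarrow> (nat, nat \<times> nat) pre_digraph" where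
  "dpa_graph m t n =
    \<lparr> verts = {1..n}, arcs = {2..n} \<times> {1..m}, tail = fst, head = (\<lambda>(r, l). t r l) \<rparr>"

text \<open>
  The degree \<open>d\<^sub>j(n)\<close>, \<open>1 \<le> j \<le> n\<close>. The last summand counts the unattached half-edges carried by \<open>v\<^sub>1\<close>.
\<close>

definition dpa_degree :: "nat \<Rightarrow> (nat \<Rightarrow> nat \<Rightarrow> nat) \<Rightarrow> nat \<Rightarrow> nat \<Rightarrow> nat" where
  "dpa_degree m t n j =
    in_degree (dpa_graph m t n) j + out_degree (dpa_graph m t n) j + (if j = 1 then m else 0)"

text \<open>
  \<open>dpa_degree_step m t n k j\<close> is \<open>d\<^sub>j(n + 1, k)\<close>, \<open>1 \<le> j \<le> n\<close>, the degree of \<open>v\<^sub>j\<close> after the first \<open>k\<close>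
  half-edges of \<open>v\<^sub>n\<^sub>+\<^sub>1\<close> have been attached.
\<close>

definition dpa_degree_step :: "nat \<Rightarrow> (nat \<Rightarrow> nat \<Rightarrow> nat) \<Rightarrow> nat \<Rightarrow> nat \<Rightarrow> nat \<Rightarrow> nat" where
  "dpa_degree_step m t n k j = dpa_degree m t n j + card {l \<in> {1..k}. t (Suc n) l = j}"

text \<open>
  The case \<open>n = 1\<close> is separate only because \<open>n * \<theta> - \<alpha>\<close> vanishes there if \<open>\<theta> = \<alpha> = 1\<close>.
\<close>

definition dpa_prob ::
    "real \<Rightarrow> real \<Rightarrow> nat \<Rightarrow> (nat \<Rightarrow> nat \<Rightarrow> nat) \<Rightarrow> nat \<Rightarrow> nat \<Rightarrow> nat \<Rightarrow> real" where
  "dpa_prob \<alpha> \<theta> m t n k j =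
    (if n = 1 then 1
     else 1 / (real n * \<theta> - \<alpha>) *
       (\<theta> - \<alpha> * real (dpa_degree_step m t n k j) / (real k + (2 * real n - 1) * real m)))"

text \<open>
  The \<open>\<sigma>\<close>-algebra \<open>F\<^sub>n\<^sub>+\<^sub>1\<^sub>,\<^sub>k\<close>, generated by the half-edges attached so far: all those of
  \<open>v\<^sub>2, \<dots>, v\<^sub>n\<close> and the first \<open>k\<close> of \<open>v\<^sub>n\<^sub>+\<^sub>1\<close>.
\<close>

definition dpa_filtration ::
    "'a measure \<Rightarrow> nat \<Rightarrow> ('a \<Rightarrow> nat \<Rightarrow> nat \<Rightarrow> nat) \<Rightarrow> nat \<Rightarrow> nat \<Rightarrow> 'a measure" where
  "dpa_filtration M m T n k = sigma (space M)
    {{\<omega> \<in> space M. T \<omega> r l = j} | r l j. (r, l) \<in> {2..n} \<times> {1..m} \<union> {Suc n} \<times> {1..k}}"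

locale linear_de_preferential_attachment = prob_space M
  for M :: "'a measure" and \<alpha> \<theta> :: real and m :: nat and T :: "'a \<Rightarrow> nat \<Rightarrow> nat \<Rightarrow> nat" +
  assumes measurable_target:
      "\<And>n k. n \<ge> 1 \<Longrightarrow> k < m \<Longrightarrow> (\<lambda>\<omega>. T \<omega> (Suc n) (Suc k)) \<in> measurable M (count_space UNIV)"
    and target_range:
      "\<And>n k \<omega>. n \<ge> 1 \<Longrightarrow> k < m \<Longrightarrow> \<omega> \<in> space M \<Longrightarrow> T \<omega> (Suc n) (Suc k) \<in> {1..n}"
    and cond_prob_target:
      "\<And>n k j. n \<ge> 1 \<Longrightarrow> k < m \<Longrightarrow> j \<in> {1..n} \<Longrightarrow>
        AE \<omega> in M. real_cond_exp M (dpa_filtration M m T n k)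
            (indicator {\<omega>' \<in> space M. T \<omega>' (Suc n) (Suc k) = j}) \<omega>
          = dpa_prob \<alpha> \<theta> m (T \<omega>) n k j"

definition degree_fraction :: "nat \<Rightarrow> (nat \<Rightarrow> nat \<Rightarrow> nat) \<Rightarrow> nat \<Rightarrow> nat \<Rightarrow> real" where
  "degree_fraction m t n k =
    1 / real n * (\<Sum>j = 1..n. of_bool (dpa_degree m t n j = k))"

end

theory Submission
  imports Defs "HOL-Real_Asymp.Real_Asymp"
begin

text \<open>
  All attachment probabilities are \<open>1/n\<close> up to an error of order \<open>(1 + d)/n\<^sup>2\<close>, so every vertex is
  hit almost as in uniform attachment.

  For a fixed vertex, let \<open>z = e\<^sup>i\<^sup>s - 1\<close>. Attaching one half-edge multiplies the characteristic
  function of \<open>d\<^sub>i\<close> at \<open>s\<close> by \<open>e\<^bsup>z/n\<^esup>\<close> up to an error \<open>O(|z| n\<^bsup>-3/2\<^esup>)\<close>, because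
  \<open>E d\<^sub>i(n) = O(\<surd>n)\<close>. These errors are summable and \<open>|e\<^bsup>z/n\<^esup>| \<le> 1\<close>, so \<open>d\<^sub>i(n)\<close> has the characteristic
  function of a Poisson variable with mean \<open>m log n + O(1)\<close> up to \<open>O(|s|)\<close>. Levy's continuity theorem
  gives the central limit theorem, and tightness gives the law of large numbers.

  For \<open>m = 1\<close>, let \<open>X\<^sub>k\<close> be the number of vertices of degree \<open>k\<close> minus \<open>n/2\<^sup>k\<close>. The drift of \<open>X\<close> is
  \<open>(S - I)X/n\<close>, with \<open>S\<close> the shift, up to an error whose \<open>l\<^sup>1\<close>-norm is \<open>O(1/n)\<close> since the degrees sum to
  \<open>2n - 1\<close>. As \<open>S\<close> is a contraction of \<open>l\<^sup>2\<close>, \<open>E (\<Sum>\<^sub>k X\<^sub>k\<^sup>2)\<close> grows by a bounded amount in each step, hence is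
  \<open>O(n)\<close>. This single second moment bounds all degrees simultaneously.
\<close>

section \<open>Degrees\<close>

lemma in_degree_dpa_graph:
  "in_degree (dpa_graph m t n) j = (\<Sum>r = 2..n. \<Sum>l = 1..m. of_bool (t r l = j))"
proof -
  have "in_degree (dpa_graph m t n) j = (\<Sum>e\<in>{2..n} \<times> {1..m}. of_bool (case e of (r, l) \<Rightarrow> t r l = j))"
    by (simp add: in_degree_def in_arcs_def dpa_graph_def Int_def case_prod_unfold)
  also have "\<dots> = (\<Sum>(r, l)\<in>{2..n} \<times> {1..m}. of_bool (t r l = j))"
    by (rule sum.cong) auto
  finally show ?thesis
    by (simp only: sum.cartesian_product)
qed

lemma out_degree_dpa_graph:
  "out_degree (dpa_graph m t n) j = (if j \<in> {2..n} then m else 0)"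
proof -
  have "out_arcs (dpa_graph m t n) j = (if j \<in> {2..n} then {j} \<times> {1..m} else {})"
    by (auto simp: out_arcs_def dpa_graph_def)
  then show ?thesis
    by (simp add: out_degree_def card_cartesian_product)
qed

text \<open>The form in which all degrees are computed. The last two summands are the m half-edges a
  vertex starts with: out-arcs for j \<ge> 2, unattached half-edges for j = 1.\<close>

lemma dpa_degree_eq:
  "dpa_degree m t n j = (\<Sum>r = 2..n. \<Sum>l = 1..m. of_bool (t r l = j))
    + (if j \<in> {2..n} then m else 0) + (if j = 1 then m else 0)"
  by (simp only: dpa_degree_def in_degree_dpa_graph out_degree_dpa_graph)

lemma dpa_degree_step_eq:
  "dpa_degree_step m t n k j = dpa_degree m t n j + (\<Sum>l = 1..k. of_bool (t (Suc n) l = j))"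
  by (simp add: dpa_degree_step_def Int_def)

lemma dpa_degree_step_0: "dpa_degree_step m t n 0 j = dpa_degree m t n j"
  by (simp add: dpa_degree_step_eq)

lemma dpa_degree_step_Suc:
  "dpa_degree_step m t n (Suc k) j = dpa_degree_step m t n k j + of_bool (t (Suc n) (Suc k) = j)"
  by (simp add: dpa_degree_step_eq)

text \<open>After m attachments the in-arcs at j are those of the next graph. The range of j
  excludes the new vertex, which also gains its m out-arcs there.\<close>

lemma dpa_degree_step_last:
  assumes "1 \<le> n" "j \<in> {1..n}"
  shows "dpa_degree_step m t n m j = dpa_degree m t (Suc n) j"
  using assms by (auto simp: dpa_degree_step_eq dpa_degree_eq)

lemma dpa_degree_step_le: "k \<le> m \<Longrightarrow> dpa_degree_step m t n k j \<le> dpa_degree m t n j + m"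
proof -
  assume "k \<le> m"
  moreover have "(\<Sum>l = 1..k. of_bool (t (Suc n) l = j)) \<le> (\<Sum>l = 1..k. (1::nat))"
    by (rule sum_mono) auto
  ultimately show ?thesis
    by (simp add: dpa_degree_step_eq)
qed

text \<open>At most m (n - 1) half-edges can hit one vertex, which starts with m. Being
  deterministic, this bound makes every function of a degree bounded, hence integrable.\<close>

lemma dpa_degree_le:
  assumes "1 \<le> n"
  shows "dpa_degree m t n j \<le> n * m"
proof -
  have "(\<Sum>r = 2..n. \<Sum>l = 1..m. of_bool (t r l = j)) \<le> (\<Sum>r = 2..n. \<Sum>l = 1..m. (1::nat))"
    by (intro sum_mono) auto
  then have "dpa_degree m t n j \<le> (n - 1) * m + m"
    by (auto simp: dpa_degree_eq)
  also have "\<dots> = n * m"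
    using assms by (cases n) auto
  finally show ?thesis .
qed

lemma dpa_degree_ge:
  assumes "j \<in> {1..n}"
  shows "m \<le> dpa_degree m t n j"
  using assms by (auto simp: dpa_degree_eq)

section \<open>Analytic preliminaries\<close>

text \<open>Increments of order 1/n are dominated by increments of a multiple of the square root.
  This is the inductive step for the bound on the expected degree.\<close>

lemma sqrt_Suc_diff_ge:
  assumes "n \<ge> 1"
  shows "1 / (4 * real n) \<le> sqrt (real (Suc n)) - sqrt (real n)"
proof -
  define a b where "a = sqrt (real (Suc n))" and "b = sqrt (real n)"
  have ab: "a \<ge> 1" "b \<ge> 1" "a\<^sup>2 = real n + 1" "b\<^sup>2 = real n"
    using assms by (auto simp: a_def b_def)
  then have "a * 1 \<le> a * a" "b * 1 \<le> b * b"
    by (intro mult_left_mono; simp)+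
  then have "a + b \<le> 4 * real n"
    using ab assms unfolding power2_eq_square by linarith
  moreover have "(a - b) * (a + b) = 1"
    using ab by (simp add: algebra_simps power2_eq_square)
  then have "a - b = 1 / (a + b)"
    using ab by (simp add: field_simps)
  ultimately show ?thesis
    using ab unfolding a_def[symmetric] b_def[symmetric] by (simp add: frac_le)
qed

text \<open>Second-order Taylor remainder; the constant comes from exp 2 \<le> 3^2. The hypothesis
  on the real part fits the later argument (\<open>iexp s\<close> - 1)/n.\<close>

lemma norm_exp_minus_one_minus_le:
  fixes z :: complex
  assumes "\<bar>Re z\<bar> \<le> 2"
  shows "norm (exp z - (1 + z)) \<le> 9 * norm z ^ 2"
proof -
  have "norm (exp z - (1 + z)) \<le> exp \<bar>Re z\<bar> * norm z ^ 2"
    using Taylor_exp[of z 1] by (simp add: numeral_2_eq_2)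
  also have "exp \<bar>Re z\<bar> \<le> exp 2"
    using assms by simp
  also have "exp 2 = exp (1 :: real) ^ 2"
    by (simp flip: exp_of_nat_mult)
  also have "\<dots> \<le> 3 ^ 2"
    using exp_le by (intro power_mono) auto
  finally show ?thesis
    by (simp add: mult_right_mono)
qed

lemma norm_iexp_minus_one_le: "norm (iexp x - 1) \<le> \<bar>x\<bar>"
  using iexp_approx1[of x 0] by simp

lemma norm_iexp_second_order_le: "norm (iexp x - 1 - \<i> * x + x\<^sup>2 / 2) \<le> \<bar>x\<bar> ^ 3 / 6"
  using iexp_approx1[of x 2]
  by (simp add: numeral_2_eq_2 numeral_3_eq_3 algebra_simps)

section \<open>Tails under weak convergence\<close>

text \<open>Tightness: continuity of the limiting cdf gives convergence at a and -a, where a is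
  chosen so that the limit has mass below \<delta>/2 outside (-a, a]; eventually c n \<ge> a. This
  turns the central limit theorem into the law of large numbers.\<close>

lemma weak_conv_m_tail:
  assumes M: "\<And>n. real_distribution (M n)" and N: "real_distribution N"
    and conv: "weak_conv_m M N" and cont: "\<And>x. isCont (cdf N) x"
    and c: "filterlim c at_top sequentially"
  shows "(\<lambda>n. measure (M n) {x. \<bar>x\<bar> > c n}) \<longlonglongrightarrow> 0"
proof (rule LIMSEQ_I)
  fix \<delta> :: real
  assume \<delta>: "\<delta> > 0"
  interpret N: real_distribution N by fact
  interpret M: real_distribution "M n" for n by fact
  have "\<forall>\<^sub>F a in at_top. cdf N (- a) < \<delta> / 4"
    using filterlim_compose[OF N.cdf_lim_at_bot filterlim_uminus_at_bot_at_top] \<delta>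
    by (intro order_tendstoD) auto
  moreover have "\<forall>\<^sub>F a in at_top. cdf N a > 1 - \<delta> / 4"
    using N.cdf_lim_at_top_prob \<delta> by (intro order_tendstoD) auto
  ultimately obtain a where a: "cdf N (- a) < \<delta> / 4" "cdf N a > 1 - \<delta> / 4"
    using eventually_happens'[OF _ eventually_conj] by (metis (mono_tags, lifting) trivial_limit_at_top_linorder)
  have lim: "(\<lambda>n. cdf (M n) x) \<longlonglongrightarrow> cdf N x" for x
    using conv cont unfolding weak_conv_m_def weak_conv_def by blast
  have "\<forall>\<^sub>F n in sequentially. cdf (M n) (- a) < \<delta> / 4"
    using lim a by (intro order_tendstoD) auto
  moreover have "\<forall>\<^sub>F n in sequentially. cdf (M n) a > 1 - \<delta> / 4"
    using lim a by (intro order_tendstoD) auto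
  moreover have "\<forall>\<^sub>F n in sequentially. c n \<ge> a"
    using c by (simp add: filterlim_at_top)
  ultimately have "\<forall>\<^sub>F n in sequentially. norm (measure (M n) {x. \<bar>x\<bar> > c n} - 0) < \<delta>"
  proof eventually_elim
    case (elim n)
    have "measure (M n) {x. \<bar>x\<bar> > c n} \<le> measure (M n) ({..- a} \<union> (UNIV - {..a}))"
      using elim(3) by (intro M.finite_measure_mono) auto
    also have "\<dots> \<le> measure (M n) {..- a} + measure (M n) (UNIV - {..a})"
      by (intro measure_Un_le) auto
    also have "measure (M n) (UNIV - {..a}) = 1 - measure (M n) {..a}"
      using M.prob_compl[of "{..a}" n] by simp
    finally show ?case
      using elim(1,2) \<delta> unfolding cdf_def2 by simp
  qed
  then show "\<exists>no. \<forall>n\<ge>no. norm (measure (M n) {x. \<bar>x\<bar> > c n} - 0) < \<delta>"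
    by (simp only: eventually_sequentially)
qed

lemma isCont_cdf_std_normal: "isCont (cdf std_normal_distribution) x"
proof -
  interpret real_distribution std_normal_distribution
    by (rule real_dist_normal_dist)
  have "AE y in lborel. y \<noteq> x"
    by (rule AE_lborel_singleton)
  then have "emeasure std_normal_distribution {x} = 0"
    by (subst emeasure_density) (auto intro!: nn_integral_0_iff_AE[THEN iffD2] simp: indicator_def)
  then show ?thesis
    by (simp add: isCont_cdf measure_def)
qed

section \<open>Harmonic sums and the normal limit of Poisson characteristic functions\<close>

lemma reciprocal_sum_asymptotics:
  assumes "i \<ge> 1"
  shows "\<exists>c. (\<lambda>n. (\<Sum>r = i..<n. 1 / real r) - ln (real n)) \<longlonglongrightarrow> c"
proof
  \<comment> \<open>The sum to be compared stops before n, while \<open>harm n\<close> includes 1/n;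
    hence the extra term 1/n, which vanishes in the limit.\<close>
  have "(\<lambda>n. harm n - ln (real n) - 1 / real n - (\<Sum>r = 1..<i. 1 / real r))
      \<longlonglongrightarrow> euler_mascheroni - 0 - (\<Sum>r = 1..<i. 1 / real r)"
    by (intro tendsto_intros euler_mascheroni_LIMSEQ lim_1_over_n)
  moreover have "\<forall>\<^sub>F n in sequentially. harm n - ln (real n) - 1 / real n - (\<Sum>r = 1..<i. 1 / real r)
      = (\<Sum>r = i..<n. 1 / real r) - ln (real n)"
    using eventually_ge_at_top[of i]
  proof eventually_elim
    case (elim n)
    have "harm n = (\<Sum>r = 1..<Suc n. 1 / real r)"
      by (simp add: harm_def atLeastLessThanSuc_atLeastAtMost inverse_eq_divide)
    also have "\<dots> = (\<Sum>r = 1..<i. 1 / real r) + (\<Sum>r = i..<n. 1 / real r) + 1 / real n"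
      using elim assms by (simp add: sum.atLeastLessThan_concat)
    finally show ?case
      by simp
  qed
  ultimately show "(\<lambda>n. (\<Sum>r = i..<n. 1 / real r) - ln (real n))
      \<longlonglongrightarrow> euler_mascheroni - 0 - (\<Sum>r = 1..<i. 1 / real r)"
    by (rule Lim_transform_eventually)
qed

text \<open>The sequence is the characteristic function at t of a Poisson variable with mean \<mu>
  L(n), centred by \<mu> log n and divided by sqrt (\<mu> log n). Its exponent splits into \<mu>
  (\<open>iexp s\<close> - 1) (L - log n), which vanishes because L - log n converges, the
  third-order Taylor error of \<open>iexp s\<close> times \<mu> log n, and -\<mu> s^2 log n / 2 =
  -t^2 / 2.\<close>

lemma tendsto_exp_of_normalised_poisson:
  fixes t \<mu> :: real and L :: "nat \<Rightarrow> real"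
  assumes \<mu>: "\<mu> > 0" and L: "(\<lambda>n. L n - ln (real n)) \<longlonglongrightarrow> c"
  defines "s \<equiv> \<lambda>n. t / sqrt (\<mu> * ln (real n))"
  shows "(\<lambda>n. exp (\<mu> * (iexp (s n) - 1) * L n - \<i> * s n * \<mu> * ln (real n)))
    \<longlonglongrightarrow> complex_of_real (exp (- (t\<^sup>2) / 2))"
proof -
  have s0: "s \<longlonglongrightarrow> 0"
    unfolding s_def using \<mu> by real_asymp
  have "(\<lambda>n. \<mu> * (iexp (s n) - 1) * complex_of_real (L n - ln (real n)))
      \<longlonglongrightarrow> \<mu> * (iexp 0 - 1) * complex_of_real c"
    using s0 L by (intro tendsto_intros) auto
  then have 1: "(\<lambda>n. \<mu> * (iexp (s n) - 1) * complex_of_real (L n - ln (real n))) \<longlonglongrightarrow> 0"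
    by simp
  \<comment> \<open>For n = 1 the logarithm is 0 and the division by zero gives \<open>s n\<close> =
    0, so the identity is claimed only for n > 1.\<close>
  have ev: "\<forall>\<^sub>F n in sequentially. \<mu> * ln (real n) * (s n)\<^sup>2 = t\<^sup>2"
    using eventually_gt_at_top[of 1]
  proof eventually_elim
    case (elim n)
    then have "\<mu> * ln (real n) > 0"
      using \<mu> by simp
    then show ?case
      by (auto simp: s_def power_divide)
  qed
  \<comment> \<open>The cubic error times \<mu> log n is t^2 |s| / 6 up to the bound, because \<mu>
    s^2 log n = t^2.\<close>
  have 2: "(\<lambda>n. \<mu> * ln (real n) * (iexp (s n) - 1 - \<i> * s n + (s n)\<^sup>2 / 2)) \<longlonglongrightarrow> 0"
  proof (rule Lim_null_comparison)
    show "\<forall>\<^sub>F n in sequentially. norm (\<mu> * ln (real n) * (iexp (s n) - 1 - \<i> * s n + (s n)\<^sup>2 / 2))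
        \<le> t\<^sup>2 * \<bar>s n\<bar> / 6"
      using ev eventually_gt_at_top[of 1]
    proof eventually_elim
      case (elim n)
      have "norm (\<mu> * ln (real n) * (iexp (s n) - 1 - \<i> * s n + (s n)\<^sup>2 / 2))
          \<le> \<mu> * ln (real n) * (\<bar>s n\<bar> ^ 3 / 6)"
        using norm_iexp_second_order_le[of "s n"] \<mu> elim(2)
        by (simp only: norm_mult norm_of_real) (intro mult_mono, auto)
      also have "\<dots> = \<mu> * ln (real n) * (s n)\<^sup>2 * \<bar>s n\<bar> / 6"
        by (simp add: power3_eq_cube power2_eq_square flip: abs_mult)
      finally show ?case
        using elim(1) by simp
    qed
    have "(\<lambda>n. t\<^sup>2 * \<bar>s n\<bar> / 6) \<longlonglongrightarrow> t\<^sup>2 * \<bar>0\<bar> / 6"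
      using s0 by (intro tendsto_intros) auto
    then show "(\<lambda>n. t\<^sup>2 * \<bar>s n\<bar> / 6) \<longlonglongrightarrow> 0"
      by simp
  qed
  have "(\<lambda>n. exp (\<mu> * (iexp (s n) - 1) * complex_of_real (L n - ln (real n))
        + \<mu> * ln (real n) * (iexp (s n) - 1 - \<i> * s n + (s n)\<^sup>2 / 2) - of_real (t\<^sup>2 / 2)))
      \<longlonglongrightarrow> exp (0 + 0 - complex_of_real (t\<^sup>2 / 2))"
    by (intro tendsto_intros 1 2)
  moreover have "\<forall>\<^sub>F n in sequentially.
      exp (\<mu> * (iexp (s n) - 1) * complex_of_real (L n - ln (real n))
        + \<mu> * ln (real n) * (iexp (s n) - 1 - \<i> * s n + (s n)\<^sup>2 / 2) - of_real (t\<^sup>2 / 2))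
      = exp (\<mu> * (iexp (s n) - 1) * L n - \<i> * s n * \<mu> * ln (real n))"
    using ev
  proof eventually_elim
    case (elim n)
    have "complex_of_real (t\<^sup>2 / 2) = \<mu> * ln (real n) * ((s n)\<^sup>2 / 2)"
      using elim by (simp flip: of_real_mult of_real_power)
    then show ?case
      by (simp add: algebra_simps)
  qed
  ultimately have "(\<lambda>n. exp (\<mu> * (iexp (s n) - 1) * L n - \<i> * s n * \<mu> * ln (real n)))
      \<longlonglongrightarrow> exp (0 + 0 - complex_of_real (t\<^sup>2 / 2))"
    by (rule Lim_transform_eventually)
  then show ?thesis
    by (simp flip: exp_of_real)
qed

lemma sum_of_bool_eq_le_1:
  fixes d :: nat
  assumes "finite A"
  shows "(\<Sum>k\<in>A. of_bool (d = k)) \<le> (1 :: real)"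
proof -
  have "(\<Sum>k\<in>A. of_bool (d = k)) = (\<Sum>k\<in>A. if d = k then 1 else 0 :: real)"
    by (intro sum.cong) auto
  also have "\<dots> \<le> 1"
    using assms by (simp add: sum.delta')
  finally show ?thesis .
qed

lemma abs_mult_le:
  fixes a b A B :: real
  shows "\<bar>a\<bar> \<le> A \<Longrightarrow> \<bar>b\<bar> \<le> B \<Longrightarrow> \<bar>a * b\<bar> \<le> A * B"
  unfolding abs_mult by (rule mult_mono) auto

lemma sum_half_powers_le: "(\<Sum>k<K. 1 / 2 ^ Suc k) \<le> (1 :: real)"
proof -
  have "(\<Sum>k<K. 1 / 2 ^ Suc k) = 1 - 1 / (2 :: real) ^ K"
    by (induction K) (simp_all add: field_simps)
  then show ?thesis
    by simp
qed

section \<open>Conditional attachment probabilities\<close>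

locale de_preferential_attachment = linear_de_preferential_attachment +
  assumes \<theta>_ge: "\<theta> \<ge> 1" and \<alpha>_pos: "0 < \<alpha>" and \<alpha>_le: "\<alpha> \<le> 1" and m_ge: "m \<ge> 1"
begin

lemma T_range:
  assumes "\<omega> \<in> space M" "r \<ge> 2" "l \<in> {1..m}"
  shows "T \<omega> r l \<in> {1..<r}"
proof -
  have "Suc (r - 1) = r" "Suc (l - 1) = l"
    using assms by auto
  moreover have "T \<omega> (Suc (r - 1)) (Suc (l - 1)) \<in> {1..r - 1}"
    using assms by (intro target_range) auto
  ultimately show ?thesis
    using assms by auto
qed

lemma T_sets:
  assumes "r \<ge> 2" "l \<in> {1..m}"
  shows "{\<omega> \<in> space M. T \<omega> r l = j} \<in> sets M"
proof -
  have "(\<lambda>\<omega>. T \<omega> (Suc (r - 1)) (Suc (l - 1))) \<in> measurable M (count_space UNIV)"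
    using assms by (intro measurable_target) auto
  then have [measurable]: "(\<lambda>\<omega>. T \<omega> r l) \<in> measurable M (count_space UNIV)"
    using assms by simp
  show ?thesis
    by measurable
qed

section \<open>The filtration and measurability\<close>

abbreviation filt :: "nat \<Rightarrow> nat \<Rightarrow> 'a measure" where
  "filt \<equiv> dpa_filtration M m T"

lemma space_filt [simp]: "space (filt n k) = space M"
  by (auto simp: dpa_filtration_def intro!: space_measure_of)

lemma filt_gen:
  assumes "r \<in> {2..n} \<and> l \<in> {1..m} \<or> r = Suc n \<and> l \<in> {1..k}"
  shows "{\<omega> \<in> space M. T \<omega> r l = j} \<in> sets (filt n k)"
proof -
  have "{\<omega> \<in> space M. T \<omega> r l = j} \<in>
      {{\<omega> \<in> space M. T \<omega> r l = j} | r l j. (r, l) \<in> {2..n} \<times> {1..m} \<union> {Suc n} \<times> {1..k}}"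
    using assms by blast
  then show ?thesis
    unfolding dpa_filtration_def by (subst sets_measure_of) (auto intro: sigma_sets.Basic)
qed

text \<open>The bound k \<le> m keeps all generators among half-edges that exist, whose targets are
  measurable by assumption.\<close>

lemma subalgebra_filt:
  assumes "n \<ge> 1" "k \<le> m"
  shows "subalgebra M (filt n k)"
proof -
  have "{{\<omega> \<in> space M. T \<omega> r l = j} | r l j. (r, l) \<in> {2..n} \<times> {1..m} \<union> {Suc n} \<times> {1..k}}
      \<subseteq> sets M"
    using assms by (auto intro!: T_sets)
  then have "sets (filt n k) \<subseteq> sets M"
    unfolding dpa_filtration_def by (subst sets_measure_of) (auto intro!: sets.sigma_sets_subset)
  then show ?thesis
    by (simp add: subalgebra_def)
qed

lemma measurable_T_filt:
  assumes "r \<in> {2..n} \<and> l \<in> {1..m} \<or> r = Suc n \<and> l \<in> {1..k}"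
  shows "(\<lambda>\<omega>. T \<omega> r l) \<in> measurable (filt n k) (count_space UNIV)"
proof (subst measurable_count_space_eq2_countable, safe)
  fix j
  have "(\<lambda>\<omega>. T \<omega> r l) -` {j} \<inter> space (filt n k) = {\<omega> \<in> space M. T \<omega> r l = j}"
    by auto
  then show "(\<lambda>\<omega>. T \<omega> r l) -` {j} \<inter> space (filt n k) \<in> sets (filt n k)"
    using filt_gen[OF assms] by simp
qed auto

lemma measurable_degree_step_filt:
  "(\<lambda>\<omega>. dpa_degree_step m (T \<omega>) n k j) \<in> measurable (filt n k) (count_space UNIV)"
proof -
  have *: "(\<lambda>\<omega>. of_bool (T \<omega> r l = j) :: nat) \<in> borel_measurable (filt n k)"
    if "r \<in> {2..n} \<and> l \<in> {1..m} \<or> r = Suc n \<and> l \<in> {1..k}" for r l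
    using measurable_compose[OF measurable_T_filt[OF that], where g = "\<lambda>x. of_bool (x = j) :: nat"]
    by simp
  have "(\<lambda>\<omega>. dpa_degree_step m (T \<omega>) n k j) \<in> borel_measurable (filt n k)"
    unfolding dpa_degree_step_eq dpa_degree_eq
    by (intro borel_measurable_add borel_measurable_sum borel_measurable_const *) auto
  then show ?thesis
    by (simp only: measurable_cong_sets[OF refl sets_borel_eq_count_space])
qed

lemma measurable_degree_filt:
  "(\<lambda>\<omega>. dpa_degree m (T \<omega>) n j) \<in> measurable (filt n 0) (count_space UNIV)"
  using measurable_degree_step_filt[of n 0 j] by (simp add: dpa_degree_step_0)

lemma measurable_degree_step:
  "n \<ge> 1 \<Longrightarrow> k \<le> m \<Longrightarrow> (\<lambda>\<omega>. dpa_degree_step m (T \<omega>) n k j) \<in> measurable M (count_space UNIV)"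
  using measurable_from_subalg[OF subalgebra_filt measurable_degree_step_filt] by blast

lemma measurable_degree:
  "(\<lambda>\<omega>. dpa_degree m (T \<omega>) n j) \<in> measurable M (count_space UNIV)"
proof (cases "n \<ge> 1")
  case True
  then show ?thesis
    using measurable_degree_step[of n 0 j] by (simp add: dpa_degree_step_0)
next
  case False
  then show ?thesis
    by (simp add: dpa_degree_eq)
qed

lemma dpa_prob_measurable:
  "(\<lambda>\<omega>. dpa_prob \<alpha> \<theta> m (T \<omega>) n k j) \<in> borel_measurable (filt n k)"
  using measurable_compose[OF measurable_degree_step_filt, of
      "\<lambda>d. if n = 1 then 1 else 1 / (real n * \<theta> - \<alpha>) *
         (\<theta> - \<alpha> * real d / (real k + (2 * real n - 1) * real m))" borel]
  by (simp add: dpa_prob_def)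

section \<open>Attachment indicators and their conditional probabilities\<close>

text \<open>The defining property of conditional expectation, tested against a bounded W known
  before the attachment. The model's conditional probabilities enter all later computations through
  this identity.\<close>

lemma expectation_target:
  fixes W :: "'a \<Rightarrow> real"
  assumes "n \<ge> 1" "k < m" "j \<in> {1..n}"
    and W: "W \<in> borel_measurable (filt n k)" and B: "\<And>\<omega>. \<omega> \<in> space M \<Longrightarrow> \<bar>W \<omega>\<bar> \<le> B"
  shows "(\<integral>\<omega>. W \<omega> * of_bool (T \<omega> (Suc n) (Suc k) = j) \<partial>M)
      = (\<integral>\<omega>. W \<omega> * dpa_prob \<alpha> \<theta> m (T \<omega>) n k j \<partial>M)"
proof -
  have sub: "subalgebra M (filt n k)"
    using assms by (intro subalgebra_filt) auto
  interpret finite_measure_subalgebra M "filt n k"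
    by unfold_locales (rule sub)
  define A where "A = {\<omega> \<in> space M. T \<omega> (Suc n) (Suc k) = j}"
  have A [measurable]: "A \<in> sets M"
    using assms by (auto simp: A_def intro!: T_sets)
  have WM [measurable]: "W \<in> borel_measurable M"
    by (rule measurable_from_subalg[OF sub W])
  have PM [measurable]: "(\<lambda>\<omega>. dpa_prob \<alpha> \<theta> m (T \<omega>) n k j) \<in> borel_measurable M"
    by (rule measurable_from_subalg[OF sub dpa_prob_measurable])
  have int: "integrable M (\<lambda>\<omega>. W \<omega> * indicator A \<omega>)"
  proof (rule integrable_const_bound[where B = B])
    have "\<bar>W \<omega> * indicator A \<omega>\<bar> \<le> B" if "\<omega> \<in> space M" for \<omega>
      using B[OF that] by (auto simp: indicator_def)
    then show "AE \<omega> in M. norm (W \<omega> * indicator A \<omega>) \<le> B"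
      by simp
  qed simp
  have "(\<integral>\<omega>. W \<omega> * of_bool (T \<omega> (Suc n) (Suc k) = j) \<partial>M) = (\<integral>\<omega>. W \<omega> * indicator A \<omega> \<partial>M)"
    by (intro Bochner_Integration.integral_cong) (auto simp: A_def)
  also have "\<dots> = (\<integral>\<omega>. W \<omega> * real_cond_exp M (filt n k) (indicator A) \<omega> \<partial>M)"
    by (rule real_cond_exp_intg(2)[OF int W, symmetric]) auto
  also have "\<dots> = (\<integral>\<omega>. W \<omega> * dpa_prob \<alpha> \<theta> m (T \<omega>) n k j \<partial>M)"
    using cond_prob_target[OF assms(1-3)]
    by (intro integral_cong_AE) (auto simp: A_def)
  finally show ?thesis .
qed

text \<open>With D = n\<theta> - \<alpha> and S the total degree, the difference is exactly
  (\<alpha>/D) (1/n - d/S). For n \<ge> 2 one has D \<ge> n/2 and S \<ge> n; for n = 1 the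
  difference is 0.\<close>

lemma dpa_prob_approx:
  assumes "n \<ge> 1" "k < m" "j \<in> {1..n}"
  shows "\<bar>dpa_prob \<alpha> \<theta> m (T \<omega>) n k j - 1 / real n\<bar>
    \<le> 2 * (1 + real (dpa_degree_step m (T \<omega>) n k j)) / real n ^ 2"
proof (cases "n = 1")
  case True
  then show ?thesis
    by (simp add: dpa_prob_def)
next
  case False
  define d where "d = real (dpa_degree_step m (T \<omega>) n k j)"
  define S where "S = real k + (2 * real n - 1) * real m"
  define D where "D = real n * \<theta> - \<alpha>"
  have n: "real n \<ge> 2"
    using False assms by auto
  have "real n * 1 \<le> real n * \<theta>"
    using \<theta>_ge n by (intro mult_left_mono) auto
  then have D: "D \<ge> real n / 2"
    using \<alpha>_le n unfolding D_def by linarith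
  have "(2 * real n - 1) * 1 \<le> (2 * real n - 1) * real m"
    using m_ge n by (intro mult_left_mono) auto
  moreover have "real n \<le> (2 * real n - 1) * 1"
    using n by simp
  ultimately have "real n \<le> (2 * real n - 1) * real m"
    by (rule order_trans[rotated])
  then have S: "S \<ge> real n"
    by (simp add: S_def)
  have d: "d \<ge> 0"
    by (simp add: d_def)
  have "dpa_prob \<alpha> \<theta> m (T \<omega>) n k j - 1 / real n = 1 / D * (\<theta> - \<alpha> * d / S) - 1 / real n"
    using False by (simp add: dpa_prob_def d_def S_def D_def)
  also have "\<dots> = \<alpha> / D * (1 / real n - d / S)"
    using n D S by (simp add: divide_simps) (simp add: D_def algebra_simps)
  finally have "\<bar>dpa_prob \<alpha> \<theta> m (T \<omega>) n k j - 1 / real n\<bar> = \<alpha> / D * \<bar>1 / real n - d / S\<bar>"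
    using \<alpha>_pos D n by (simp add: abs_mult)
  also have "\<dots> \<le> 1 / (real n / 2) * ((1 + d) / real n)"
  proof (intro mult_mono frac_le)
    have "d / S \<le> d / real n"
      using S d n by (intro divide_left_mono) auto
    moreover have "d / S \<ge> 0" "1 / real n \<ge> 0"
      using d S n by auto
    ultimately show "\<bar>1 / real n - d / S\<bar> \<le> (1 + d) / real n"
      unfolding add_divide_distrib abs_le_iff by linarith
  qed (use \<alpha>_le D n in auto)
  also have "\<dots> = 2 * (1 + d) / real n ^ 2"
    by (simp add: power2_eq_square)
  finally show ?thesis
    by (simp add: d_def)
qed

text \<open>Dropping the degree term leaves \<theta>/(n\<theta> - \<alpha>), and n\<theta> \<ge> 2
  \<ge> 2\<alpha> for n \<ge> 2 keeps the denominator above n\<theta>/2. No degree occurs in the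
  bound, so it can be used to estimate the expected degree, which the error term of
  \<open>dpa_prob_approx\<close> requires.\<close>

lemma dpa_prob_le:
  assumes "n \<ge> 1" "k < m"
  shows "dpa_prob \<alpha> \<theta> m (T \<omega>) n k j \<le> 2 / real n"
proof (cases "n = 1")
  case True
  then show ?thesis
    by (simp add: dpa_prob_def)
next
  case False
  then have n: "real n \<ge> 2"
    using assms by auto
  have "2 * 1 \<le> real n * \<theta>"
    using \<theta>_ge n by (intro mult_mono) auto
  then have D: "real n * \<theta> / 2 \<le> real n * \<theta> - \<alpha>"
    using \<alpha>_le by linarith
  have D0: "0 < real n * \<theta> - \<alpha>"
    using \<open>2 * 1 \<le> real n * \<theta>\<close> \<alpha>_le by linarith
  have "dpa_prob \<alpha> \<theta> m (T \<omega>) n k j \<le> 1 / (real n * \<theta> - \<alpha>) * \<theta>"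
    unfolding dpa_prob_def if_not_P[OF False] using D0 n \<alpha>_pos by (intro mult_left_mono) auto
  also have "\<dots> \<le> 1 / (real n * \<theta> / 2) * \<theta>"
    using D D0 n \<theta>_ge by (intro mult_right_mono divide_left_mono mult_pos_pos) auto
  also have "\<dots> = 2 / real n"
    using n \<theta>_ge by simp
  finally show ?thesis .
qed

text \<open>The degree takes finitely many values, so f of it is bounded by the sum of all norms,
  whatever f is.\<close>

lemma integrable_degree_step:
  fixes f :: "nat \<Rightarrow> 'b :: {banach, second_countable_topology}"
  assumes "n \<ge> 1" "k \<le> m"
  shows "integrable M (\<lambda>\<omega>. f (dpa_degree_step m (T \<omega>) n k j))"
proof (rule integrable_const_bound[where B = "\<Sum>d\<le>n * m + m. norm (f d)"])
  have "norm (f (dpa_degree_step m (T \<omega>) n k j)) \<le> (\<Sum>d\<le>n * m + m. norm (f d))" for \<omega>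
    using dpa_degree_step_le[OF assms(2), of "T \<omega>" n j] dpa_degree_le[OF assms(1), of m "T \<omega>" j]
    by (intro member_le_sum) auto
  then show "AE \<omega> in M. norm (f (dpa_degree_step m (T \<omega>) n k j)) \<le> (\<Sum>d\<le>n * m + m. norm (f d))"
    by simp
  show "(\<lambda>\<omega>. f (dpa_degree_step m (T \<omega>) n k j)) \<in> borel_measurable M"
    using measurable_compose[OF measurable_degree_step[OF assms], of f borel] by simp
qed

lemma integrable_degree_step_target:
  fixes f :: "nat \<Rightarrow> 'b :: {banach, second_countable_topology, real_normed_algebra_1}"
  assumes "n \<ge> 1" "k < m"
  shows "integrable M (\<lambda>\<omega>. f (dpa_degree_step m (T \<omega>) n k j) * of_bool (T \<omega> (Suc n) (Suc k) = j))"
proof -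
  define A where "A = {\<omega> \<in> space M. T \<omega> (Suc n) (Suc k) = j}"
  have "integrable M (\<lambda>\<omega>. indicator A \<omega> *\<^sub>R f (dpa_degree_step m (T \<omega>) n k j))"
    unfolding A_def using assms by (intro integrable_mult_indicator integrable_degree_step T_sets) auto
  also have "?this \<longleftrightarrow> ?thesis"
    by (intro Bochner_Integration.integrable_cong) (auto simp: A_def)
  finally show ?thesis .
qed

section \<open>The degree of a fixed vertex\<close>

text \<open>Conditional expectations are real-valued here, so the identity is applied to the real
  and imaginary parts separately.\<close>

lemma expectation_degree_step_target:
  fixes f :: "nat \<Rightarrow> complex"
  assumes "n \<ge> 1" "k < m" "j \<in> {1..n}"
  shows "(\<integral>\<omega>. f (dpa_degree_step m (T \<omega>) n k j) * of_bool (T \<omega> (Suc n) (Suc k) = j) \<partial>M)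
    = (\<integral>\<omega>. f (dpa_degree_step m (T \<omega>) n k j) * of_real (dpa_prob \<alpha> \<theta> m (T \<omega>) n k j) \<partial>M)"
proof -
  let ?d = "\<lambda>\<omega>. dpa_degree_step m (T \<omega>) n k j"
  let ?b = "\<lambda>\<omega>. T \<omega> (Suc n) (Suc k) = j"
  let ?p = "\<lambda>\<omega>. dpa_prob \<alpha> \<theta> m (T \<omega>) n k j"
  have real: "(\<integral>\<omega>. g (?d \<omega>) * of_bool (?b \<omega>) \<partial>M) = (\<integral>\<omega>. g (?d \<omega>) * ?p \<omega> \<partial>M)"
    for g :: "nat \<Rightarrow> real"
  proof (rule expectation_target[OF assms, where B = "\<Sum>d\<le>n * m + m. \<bar>g d\<bar>"])
    show "(\<lambda>\<omega>. g (?d \<omega>)) \<in> borel_measurable (filt n k)"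
      using measurable_compose[OF measurable_degree_step_filt, of g borel] by simp
    show "\<bar>g (?d \<omega>)\<bar> \<le> (\<Sum>d\<le>n * m + m. \<bar>g d\<bar>)" for \<omega>
      using dpa_degree_step_le[of k m "T \<omega>" n j] dpa_degree_le[OF assms(1), of m "T \<omega>" j] assms
      by (intro member_le_sum) auto
  qed
  define q where "q d = (if n = 1 then 1 else 1 / (real n * \<theta> - \<alpha>) *
       (\<theta> - \<alpha> * real d / (real k + (2 * real n - 1) * real m)))" for d
  have q: "?p \<omega> = q (?d \<omega>)" for \<omega>
    by (simp add: dpa_prob_def q_def)
  have I1: "integrable M (\<lambda>\<omega>. f (?d \<omega>) * of_bool (?b \<omega>))"
    using assms by (intro integrable_degree_step_target) auto
  have I2: "integrable M (\<lambda>\<omega>. f (?d \<omega>) * of_real (?p \<omega>))"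
    unfolding q using assms
    by (intro integrable_degree_step[where f = "\<lambda>d. f d * of_real (q d)"]) auto
  show ?thesis
  proof (rule complex_eqI)
    show "Re (\<integral>\<omega>. f (?d \<omega>) * of_bool (?b \<omega>) \<partial>M) = Re (\<integral>\<omega>. f (?d \<omega>) * of_real (?p \<omega>) \<partial>M)"
    proof -
      have "Re (\<integral>\<omega>. f (?d \<omega>) * of_bool (?b \<omega>) \<partial>M) = (\<integral>\<omega>. Re (f (?d \<omega>)) * of_bool (?b \<omega>) \<partial>M)"
        by (subst integral_Re[OF I1, symmetric]) (auto intro!: Bochner_Integration.integral_cong)
      also have "\<dots> = (\<integral>\<omega>. Re (f (?d \<omega>)) * ?p \<omega> \<partial>M)"
        by (rule real)
      also have "\<dots> = Re (\<integral>\<omega>. f (?d \<omega>) * of_real (?p \<omega>) \<partial>M)"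
        by (subst integral_Re[OF I2, symmetric]) simp
      finally show ?thesis .
    qed
    show "Im (\<integral>\<omega>. f (?d \<omega>) * of_bool (?b \<omega>) \<partial>M) = Im (\<integral>\<omega>. f (?d \<omega>) * of_real (?p \<omega>) \<partial>M)"
    proof -
      have "Im (\<integral>\<omega>. f (?d \<omega>) * of_bool (?b \<omega>) \<partial>M) = (\<integral>\<omega>. Im (f (?d \<omega>)) * of_bool (?b \<omega>) \<partial>M)"
        by (subst integral_Im[OF I1, symmetric]) (auto intro!: Bochner_Integration.integral_cong)
      also have "\<dots> = (\<integral>\<omega>. Im (f (?d \<omega>)) * ?p \<omega> \<partial>M)"
        by (rule real)
      also have "\<dots> = Im (\<integral>\<omega>. f (?d \<omega>) * of_real (?p \<omega>) \<partial>M)"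
        by (subst integral_Im[OF I2, symmetric]) simp
      finally show ?thesis .
    qed
  qed
qed

section \<open>First moment of a degree\<close>

lemma expectation_degree_step_Suc_le:
  assumes "n \<ge> 1" "k < m" "j \<in> {1..n}"
  shows "(\<integral>\<omega>. real (dpa_degree_step m (T \<omega>) n (Suc k) j) \<partial>M)
    \<le> (\<integral>\<omega>. real (dpa_degree_step m (T \<omega>) n k j) \<partial>M) + 2 / real n"
proof -
  have "(\<integral>\<omega>. real (dpa_degree_step m (T \<omega>) n (Suc k) j) \<partial>M)
      = (\<integral>\<omega>. real (dpa_degree_step m (T \<omega>) n k j) + 1 * of_bool (T \<omega> (Suc n) (Suc k) = j) \<partial>M)"
    by (simp add: dpa_degree_step_Suc)
  also have "\<dots> = (\<integral>\<omega>. real (dpa_degree_step m (T \<omega>) n k j) \<partial>M)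
      + (\<integral>\<omega>. 1 * of_bool (T \<omega> (Suc n) (Suc k) = j) \<partial>M)"
    using assms integrable_degree_step_target[of n k "\<lambda>_. 1 :: real" j]
    by (intro Bochner_Integration.integral_add integrable_degree_step) auto
  also have "(\<integral>\<omega>. 1 * of_bool (T \<omega> (Suc n) (Suc k) = j) \<partial>M)
      = (\<integral>\<omega>. 1 * dpa_prob \<alpha> \<theta> m (T \<omega>) n k j \<partial>M)"
    by (rule expectation_target[OF assms, where B = 1]) auto
  also have "(\<integral>\<omega>. 1 * dpa_prob \<alpha> \<theta> m (T \<omega>) n k j \<partial>M) \<le> 2 / real n"
  proof (rule integral_le_const)
    show "integrable M (\<lambda>\<omega>. 1 * dpa_prob \<alpha> \<theta> m (T \<omega>) n k j)"
      unfolding dpa_prob_def using assms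
      by (intro integrable_degree_step[where f = "\<lambda>d. 1 * (if n = 1 then 1 else 1 / (real n * \<theta> - \<alpha>) *
       (\<theta> - \<alpha> * real d / (real k + (2 * real n - 1) * real m)))"]) auto
  qed (use dpa_prob_le assms in auto)
  finally show ?thesis
    by simp
qed

lemma expectation_degree_step_le:
  assumes "n \<ge> 1" "k \<le> m" "j \<in> {1..n}"
  shows "(\<integral>\<omega>. real (dpa_degree_step m (T \<omega>) n k j) \<partial>M)
    \<le> (\<integral>\<omega>. real (dpa_degree m (T \<omega>) n j) \<partial>M) + real k * (2 / real n)"
  using assms(2)
proof (induction k)
  case (Suc k)
  then show ?case
    using expectation_degree_step_Suc_le[of n k j] assms by (simp add: algebra_simps add_divide_distrib)
qed (simp add: dpa_degree_step_0)

text \<open>One new vertex adds at most 2m/n, which is at most the increment of 8 m i sqrt n. The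
  factor i covers the initial value, at most i m. The rate is crude but sufficient: after division
  by n^2 it is summable.\<close>

lemma expectation_degree_le_sqrt:
  assumes "i \<ge> 1" "n \<ge> i"
  shows "(\<integral>\<omega>. real (dpa_degree m (T \<omega>) n i) \<partial>M) \<le> 8 * real m * real i * sqrt (real n)"
  using assms(2)
proof (induction n rule: dec_induct)
  case base
  have "(\<integral>\<omega>. real (dpa_degree m (T \<omega>) i i) \<partial>M) \<le> real (i * m)"
    using integrable_degree_step[of i 0 real i] dpa_degree_le[OF assms(1), of m _ i] assms
    by (intro integral_le_const) (auto simp: dpa_degree_step_0 simp del: of_nat_mult)
  also have "\<dots> = 1 * real (i * m)"
    by simp
  also have "\<dots> \<le> (8 * sqrt (real i)) * real (i * m)"
  proof (rule mult_right_mono)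
    have "1 \<le> sqrt (real i)"
      using assms by simp
    then show "1 \<le> 8 * sqrt (real i)"
      by linarith
  qed simp
  finally show ?case
    by (simp add: mult_ac)
next
  case (step n)
  have n: "n \<ge> 1"
    using step assms by simp
  have "(\<integral>\<omega>. real (dpa_degree m (T \<omega>) (Suc n) i) \<partial>M)
      = (\<integral>\<omega>. real (dpa_degree_step m (T \<omega>) n m i) \<partial>M)"
    using n assms step by (simp add: dpa_degree_step_last)
  also have "\<dots> \<le> (\<integral>\<omega>. real (dpa_degree m (T \<omega>) n i) \<partial>M) + real m * (2 / real n)"
    using n assms step by (intro expectation_degree_step_le) auto
  also have "\<dots> \<le> 8 * real m * real i * sqrt (real n) + 8 * (real m * real i) * (1 / (4 * real n))"
  proof (intro add_mono step.IH)
    have "real m * (2 / real n) * 1 \<le> real m * (2 / real n) * real i"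
      using assms by (intro mult_left_mono) auto
    then show "real m * (2 / real n) \<le> 8 * (real m * real i) * (1 / (4 * real n))"
      by (simp add: field_simps)
  qed
  also have "\<dots> \<le> 8 * real m * real i * sqrt (real n)
      + 8 * (real m * real i) * (sqrt (real (Suc n)) - sqrt (real n))"
    using sqrt_Suc_diff_ge[OF n] by (intro add_left_mono mult_left_mono) auto
  finally show ?case
    by (simp add: algebra_simps)
qed

section \<open>Recursion for the characteristic function\<close>

text \<open>A hit multiplies \<open>iexp (s d)\<close> by 1 + z, a miss by 1. Conditioning replaces
  the indicator of a hit by its probability, which is replaced by 1/n, and finally 1 + z/n by exp
  (z/n). The last two replacements cost the constants 2 + 4m + 16mi and 18.\<close>

lemma char_degree_step_Suc:
  assumes "i \<ge> 1" "n \<ge> i" "k < m"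
  defines "z \<equiv> \<lambda>s. iexp s - 1"
  shows "norm ((\<integral>\<omega>. iexp (s * real (dpa_degree_step m (T \<omega>) n (Suc k) i)) \<partial>M)
      - exp (z s / real n) * (\<integral>\<omega>. iexp (s * real (dpa_degree_step m (T \<omega>) n k i)) \<partial>M))
    \<le> norm (z s) * ((20 + 4 * real m + 16 * real m * real i) * (sqrt (real n) / real n ^ 2))"
proof -
  let ?d = "\<lambda>\<omega>. dpa_degree_step m (T \<omega>) n k i"
  let ?p = "\<lambda>\<omega>. dpa_prob \<alpha> \<theta> m (T \<omega>) n k i"
  define \<phi> where "\<phi> = (\<integral>\<omega>. iexp (s * real (?d \<omega>)) \<partial>M)"
  have n: "n \<ge> 1" "i \<in> {1..n}"
    using assms by auto
  have int: "integrable M (\<lambda>\<omega>. iexp (s * real (?d \<omega>)))"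
    using n assms by (intro integrable_degree_step) auto
  define q where "q d = (if n = 1 then 1 else 1 / (real n * \<theta> - \<alpha>) *
       (\<theta> - \<alpha> * real d / (real k + (2 * real n - 1) * real m)))" for d
  have q: "?p \<omega> = q (?d \<omega>)" for \<omega>
    by (simp add: dpa_prob_def q_def)
  have intp: "integrable M (\<lambda>\<omega>. iexp (s * real (?d \<omega>)) * of_real (?p \<omega>))"
    unfolding q using n assms
    by (intro integrable_degree_step[where f = "\<lambda>d. iexp (s * real d) * of_real (q d)"]) auto
  have "(\<integral>\<omega>. iexp (s * real (dpa_degree_step m (T \<omega>) n (Suc k) i)) \<partial>M)
      = (\<integral>\<omega>. iexp (s * real (?d \<omega>))
          + z s * (iexp (s * real (?d \<omega>)) * of_bool (T \<omega> (Suc n) (Suc k) = i)) \<partial>M)"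
    by (intro Bochner_Integration.integral_cong refl)
      (auto simp: dpa_degree_step_Suc z_def algebra_simps exp_add)
  also have "\<dots> = \<phi> + (\<integral>\<omega>. z s * (iexp (s * real (?d \<omega>)) * of_bool (T \<omega> (Suc n) (Suc k) = i)) \<partial>M)"
    unfolding \<phi>_def using n assms
    by (intro Bochner_Integration.integral_add int integrable_mult_right
        integrable_degree_step_target[where f = "\<lambda>d. iexp (s * real d)"]) auto
  also have "\<dots> = \<phi> + z s * (\<integral>\<omega>. iexp (s * real (?d \<omega>)) * of_bool (T \<omega> (Suc n) (Suc k) = i) \<partial>M)"
    by simp
  also have "(\<integral>\<omega>. iexp (s * real (?d \<omega>)) * of_bool (T \<omega> (Suc n) (Suc k) = i) \<partial>M)
      = (\<integral>\<omega>. iexp (s * real (?d \<omega>)) * of_real (?p \<omega>) \<partial>M)"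
    using n assms by (intro expectation_degree_step_target[where f = "\<lambda>d. iexp (s * real d)"]) auto
  also have "\<dots> = (\<integral>\<omega>. iexp (s * real (?d \<omega>)) * of_real (?p \<omega> - 1 / real n)
      + iexp (s * real (?d \<omega>)) * of_real (1 / real n) \<partial>M)"
    by (simp add: algebra_simps)
  also have "\<dots> = (\<integral>\<omega>. iexp (s * real (?d \<omega>)) * of_real (?p \<omega> - 1 / real n) \<partial>M)
      + \<phi> * of_real (1 / real n)"
    unfolding \<phi>_def using int intp
    by (subst Bochner_Integration.integral_add) (auto simp: right_diff_distrib simp del: of_real_divide)
  finally have eq: "(\<integral>\<omega>. iexp (s * real (dpa_degree_step m (T \<omega>) n (Suc k) i)) \<partial>M) - exp (z s / real n) * \<phi>
      = z s * (\<integral>\<omega>. iexp (s * real (?d \<omega>)) * of_real (?p \<omega> - 1 / real n) \<partial>M)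
        - (exp (z s / real n) - (1 + z s / real n)) * \<phi>"
    by (simp add: algebra_simps)
  have "norm (\<integral>\<omega>. iexp (s * real (?d \<omega>)) * of_real (?p \<omega> - 1 / real n) \<partial>M)
      \<le> (\<integral>\<omega>. 2 / real n ^ 2 * (1 + real (?d \<omega>)) \<partial>M)"
  proof (rule order_trans[OF integral_norm_bound integral_mono])
    show "integrable M (\<lambda>\<omega>. norm (iexp (s * real (?d \<omega>)) * of_real (?p \<omega> - 1 / real n)))"
      using int intp by (intro integrable_norm) (simp add: right_diff_distrib)
    show "integrable M (\<lambda>\<omega>. 2 / real n ^ 2 * (1 + real (?d \<omega>)))"
      using n assms by (intro integrable_degree_step) auto
    show "norm (iexp (s * real (?d \<omega>)) * of_real (?p \<omega> - 1 / real n)) \<le> 2 / real n ^ 2 * (1 + real (?d \<omega>))"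
      for \<omega>
      using dpa_prob_approx[of n k i \<omega>] n assms by (simp add: norm_mult del: of_real_diff)
  qed
  also have "\<dots> = 2 / real n ^ 2 * (1 + (\<integral>\<omega>. real (?d \<omega>) \<partial>M))"
    using n assms integrable_degree_step[of n k real i] by (simp add: prob_space)
  \<comment> \<open>The constant terms are absorbed using sqrt n \<ge> 1, so that a single rate
    n^(-3/2) remains.\<close>
  also have "\<dots> \<le> 2 / real n ^ 2 * ((1 + 2 * real m + 8 * real m * real i) * sqrt (real n))"
  proof (intro mult_left_mono)
    have "real k * (2 / real n) \<le> real m * (2 / 1)"
      using n assms by (intro mult_mono divide_left_mono) auto
    then have "(\<integral>\<omega>. real (?d \<omega>) \<partial>M) \<le> 8 * real m * real i * sqrt (real n) + 2 * real m"
      using expectation_degree_step_le[of n k i] expectation_degree_le_sqrt[of i n] n assms by simp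
    moreover have "1 + 2 * real m \<le> (1 + 2 * real m) * sqrt (real n)"
      using n mult_left_mono[of 1 "sqrt (real n)" "1 + 2 * real m"] by simp
    ultimately show "1 + (\<integral>\<omega>. real (?d \<omega>) \<partial>M) \<le> (1 + 2 * real m + 8 * real m * real i) * sqrt (real n)"
      by (simp add: algebra_simps)
  qed auto
  finally have 1: "norm (\<integral>\<omega>. iexp (s * real (?d \<omega>)) * of_real (?p \<omega> - 1 / real n) \<partial>M)
      \<le> (2 + 4 * real m + 16 * real m * real i) * (sqrt (real n) / real n ^ 2)"
    by (simp add: algebra_simps)
  have z2: "norm (z s) \<le> 2"
    unfolding z_def by (rule order_trans[OF norm_triangle_ineq4]) simp
  have \<phi>1: "norm \<phi> \<le> 1"
    using integral_norm_bound[of M "\<lambda>\<omega>. iexp (s * real (?d \<omega>))"]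
    by (simp add: \<phi>_def prob_space)
  \<comment> \<open>Of the two factors |z| in the quadratic error one is bounded by 2 and the other
    is kept: the final error must vanish with s.\<close>
  have "norm (exp (z s / real n) - (1 + z s / real n)) \<le> norm (z s) * (18 * (sqrt (real n) / real n ^ 2))"
  proof -
    have "\<bar>Re (z s / real n)\<bar> \<le> norm (z s / real n)"
      by (rule abs_Re_le_cmod)
    also have "\<dots> \<le> 2 / 1"
      unfolding norm_divide using z2 n by (intro frac_le) auto
    finally have "norm (exp (z s / real n) - (1 + z s / real n)) \<le> 9 * norm (z s / real n) ^ 2"
      by (intro norm_exp_minus_one_minus_le) simp
    also have "\<dots> = norm (z s) * (norm (z s) * (9 * (1 / real n ^ 2)))"
      by (simp add: norm_divide power2_eq_square)
    also have "\<dots> \<le> norm (z s) * (2 * (9 * (sqrt (real n) / real n ^ 2)))"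
      using z2 n by (intro mult_left_mono mult_mono divide_right_mono) auto
    finally show ?thesis
      by simp
  qed
  then have 2: "norm ((exp (z s / real n) - (1 + z s / real n)) * \<phi>)
      \<le> norm (z s) * (18 * (sqrt (real n) / real n ^ 2))"
    using \<phi>1 by (simp add: norm_mult order_trans[OF mult_left_le])
  have "norm ((\<integral>\<omega>. iexp (s * real (dpa_degree_step m (T \<omega>) n (Suc k) i)) \<partial>M) - exp (z s / real n) * \<phi>)
      \<le> norm (z s) * ((2 + 4 * real m + 16 * real m * real i) * (sqrt (real n) / real n ^ 2))
        + norm (z s) * (18 * (sqrt (real n) / real n ^ 2))"
    unfolding eq using 1 2
    by (intro order_trans[OF norm_triangle_ineq4] add_mono)
      (simp_all only: norm_mult mult_left_mono norm_ge_zero)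
  also have "\<dots> = norm (z s) * ((20 + 4 * real m + 16 * real m * real i) * (sqrt (real n) / real n ^ 2))"
    by (simp only: distrib_left[symmetric] distrib_right[symmetric]) simp
  finally show ?thesis
    by (simp only: \<phi>_def)
qed

lemma Re_iexp_minus_one_le_0: "Re (iexp s - 1) \<le> 0"
  by (simp add: Re_exp)

text \<open>Since Re z \<le> 0, the multiplier exp (z/n) has modulus at most 1. Earlier errors are
  therefore not amplified, and m attachments cost m times the error of one.\<close>

lemma char_degree_Suc:
  fixes z :: "real \<Rightarrow> complex"
  assumes "i \<ge> 1" "n \<ge> i"
  defines "z \<equiv> \<lambda>s. iexp s - 1"
  shows "norm ((\<integral>\<omega>. iexp (s * real (dpa_degree m (T \<omega>) (Suc n) i)) \<partial>M)
      - exp (real m * z s / real n) * (\<integral>\<omega>. iexp (s * real (dpa_degree m (T \<omega>) n i)) \<partial>M))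
    \<le> real m * (norm (z s) * ((20 + 4 * real m + 16 * real m * real i) * (sqrt (real n) / real n ^ 2)))"
proof -
  define e where "e = norm (z s) * ((20 + 4 * real m + 16 * real m * real i) * (sqrt (real n) / real n ^ 2))"
  define \<phi> where "\<phi> k = (\<integral>\<omega>. iexp (s * real (dpa_degree_step m (T \<omega>) n k i)) \<partial>M)" for k
  have w: "norm (exp (z s / real n)) \<le> 1"
    using Re_iexp_minus_one_le_0[of s] by (simp add: z_def divide_nonpos_nonneg)
  have "norm (\<phi> k - exp (z s / real n) ^ k * \<phi> 0) \<le> real k * e" if "k \<le> m" for k
    using that
  proof (induction k)
    case (Suc k)
    have "norm (\<phi> (Suc k) - exp (z s / real n) ^ Suc k * \<phi> 0)
        = norm ((\<phi> (Suc k) - exp (z s / real n) * \<phi> k) + exp (z s / real n) * (\<phi> k - exp (z s / real n) ^ k * \<phi> 0))"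
      by (simp add: algebra_simps)
    also have "\<dots> \<le> e + 1 * (real k * e)"
    proof (intro order_trans[OF norm_triangle_ineq] add_mono)
      show "norm (\<phi> (Suc k) - exp (z s / real n) * \<phi> k) \<le> e"
        using char_degree_step_Suc[of i n k s] Suc.prems assms(1,2) by (simp only: \<phi>_def e_def z_def)
      show "norm (exp (z s / real n) * (\<phi> k - exp (z s / real n) ^ k * \<phi> 0)) \<le> 1 * (real k * e)"
        unfolding norm_mult using w Suc by (intro mult_mono) auto
    qed
    finally show ?case
      by (simp add: algebra_simps)
  qed simp
  from this[of m] show ?thesis
    using assms(1,2) unfolding e_def \<phi>_def
    by (simp add: dpa_degree_step_last dpa_degree_step_0 flip: exp_of_nat_mult)
qed

text \<open>Multiplying the one-step factors gives the characteristic function of a Poisson variable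
  with mean m times the harmonic sum. The factors have modulus at most 1, so the errors add up, and
  their sum is bounded because n^(-3/2) is summable. C depends on neither s nor n, which allows s to
  vary with n later.\<close>

lemma char_degree_approx:
  assumes "i \<ge> 1"
  shows "\<exists>C. \<forall>s. \<forall>n\<ge>i. norm ((\<integral>\<omega>. iexp (s * real (dpa_degree m (T \<omega>) n i)) \<partial>M)
      - exp (real m * (iexp s - 1) * (\<Sum>r = i..<n. 1 / real r))) \<le> C * \<bar>s\<bar>"
proof -
  define K where "K = 20 + 4 * real m + 16 * real m * real i"
  have "summable (\<lambda>n. sqrt (real n) / real n ^ 2)"
  proof (subst summable_cong)
    show "\<forall>\<^sub>F n in sequentially. sqrt (real n) / real n ^ 2 = real n powr (- 3 / 2)"
      using eventually_gt_at_top[of 0]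
    proof eventually_elim
      case (elim n)
      have "sqrt (real n) / real n ^ 2 = real n powr (1 / 2) / real n powr 2"
        using elim by (simp add: powr_half_sqrt powr_numeral)
      also have "\<dots> = real n powr (1 / 2 - 2)"
        by (simp only: powr_diff)
      finally show ?case
        by simp
    qed
  qed (simp add: summable_real_powr_iff)
  then have B: "(\<Sum>r = i..<n. sqrt (real r) / real r ^ 2) \<le> (\<Sum>r. sqrt (real r) / real r ^ 2)" for n
    by (intro sum_le_suminf) auto
  define B where "B = (\<Sum>r. sqrt (real r) / real r ^ 2)"
  define \<phi> where "\<phi> s n = (\<integral>\<omega>. iexp (s * real (dpa_degree m (T \<omega>) n i)) \<partial>M)" for s n
  define \<psi> where "\<psi> s n = exp (real m * (iexp s - 1) * (\<Sum>r = i..<n. 1 / real r))" for s n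
  have \<psi>1: "norm (\<psi> s n) \<le> 1" for s n
  proof -
    have "real m * Re (iexp s - 1) * (\<Sum>r = i..<n. 1 / real r) \<le> 0"
      using Re_iexp_minus_one_le_0[of s]
      by (intro mult_nonpos_nonneg[OF mult_nonneg_nonpos] sum_nonneg) auto
    moreover have "Re (real m * (iexp s - 1) * complex_of_real (\<Sum>r = i..<n. 1 / real r))
        = real m * Re (iexp s - 1) * (\<Sum>r = i..<n. 1 / real r)"
      by (simp only: Re_complex_of_real Im_complex_of_real times_complex.sel) simp
    ultimately show ?thesis
      by (simp only: \<psi>_def norm_exp_eq_Re exp_le_one_iff)
  qed
  \<comment> \<open>At n = i the Poisson factor is 1, the sum in the exponent being empty; the bound
    i m on the degree makes the initial error linear in |s|.\<close>
  have init: "norm (\<phi> s i - 1) \<le> \<bar>s\<bar> * real (i * m)" for s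
  proof -
    have int: "integrable M (\<lambda>\<omega>. iexp (s * real (dpa_degree m (T \<omega>) i i)))"
      using integrable_degree_step[of i 0 "\<lambda>d. iexp (s * real d)" i] assms
      by (simp add: dpa_degree_step_0)
    have "\<phi> s i - 1 = (\<integral>\<omega>. iexp (s * real (dpa_degree m (T \<omega>) i i)) - 1 \<partial>M)"
      unfolding \<phi>_def using int by (subst Bochner_Integration.integral_diff) (auto simp: prob_space)
    also have "norm \<dots> \<le> (\<integral>\<omega>. \<bar>s\<bar> * real (i * m) \<partial>M)"
    proof (rule order_trans[OF integral_norm_bound integral_mono])
      show "integrable M (\<lambda>\<omega>. norm (iexp (s * real (dpa_degree m (T \<omega>) i i)) - 1))"
        using int by (intro integrable_norm Bochner_Integration.integrable_diff) auto
      show "norm (iexp (s * real (dpa_degree m (T \<omega>) i i)) - 1) \<le> \<bar>s\<bar> * real (i * m)" for \<omega>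
      proof (rule order_trans[OF norm_iexp_minus_one_le])
        show "\<bar>s * real (dpa_degree m (T \<omega>) i i)\<bar> \<le> \<bar>s\<bar> * real (i * m)"
          using dpa_degree_le[OF assms, of m "T \<omega>" i]
          by (simp only: abs_mult abs_of_nat) (intro mult_left_mono, auto simp flip: of_nat_mult)
      qed
    qed simp
    finally show ?thesis
      by (simp add: prob_space)
  qed
  have step: "norm (\<phi> s n - \<psi> s n)
      \<le> \<bar>s\<bar> * real (i * m) + real m * (\<bar>s\<bar> * (K * (\<Sum>r = i..<n. sqrt (real r) / real r ^ 2)))"
    if "n \<ge> i" for s n
    using that
  proof (induction n rule: dec_induct)
    case base
    then show ?case
      using init[of s] by (simp add: \<psi>_def)
  next
    case (step n)
    define w where "w = exp (real m * (iexp s - 1) / real n)"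
    have w: "norm w \<le> 1"
      using Re_iexp_minus_one_le_0[of s]
      by (simp add: w_def mult_nonneg_nonpos divide_nonpos_nonneg)
    have "(\<Sum>r = i..<Suc n. 1 / real r) = 1 / real n + (\<Sum>r = i..<n. 1 / real r)"
      using step by simp
    then have "\<psi> s (Suc n) = w * \<psi> s n"
      by (simp only: \<psi>_def w_def of_real_add distrib_left exp_add) simp
    then have "\<phi> s (Suc n) - \<psi> s (Suc n) = (\<phi> s (Suc n) - w * \<phi> s n) + w * (\<phi> s n - \<psi> s n)"
      by (simp add: algebra_simps)
    also have "norm \<dots> \<le> real m * (\<bar>s\<bar> * (K * (sqrt (real n) / real n ^ 2))) + 1 * norm (\<phi> s n - \<psi> s n)"
    proof (intro order_trans[OF norm_triangle_ineq] add_mono)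
      have "norm (\<phi> s (Suc n) - w * \<phi> s n)
          \<le> real m * (norm (iexp s - 1) * (K * (sqrt (real n) / real n ^ 2)))"
        using char_degree_Suc[of i n s] step assms by (simp only: \<phi>_def w_def K_def)
      also have "\<dots> \<le> real m * (\<bar>s\<bar> * (K * (sqrt (real n) / real n ^ 2)))"
        using norm_iexp_minus_one_le[of s] by (intro mult_left_mono mult_right_mono) (auto simp: K_def)
      finally show "norm (\<phi> s (Suc n) - w * \<phi> s n) \<le> real m * (\<bar>s\<bar> * (K * (sqrt (real n) / real n ^ 2)))" .
      show "norm (w * (\<phi> s n - \<psi> s n)) \<le> 1 * norm (\<phi> s n - \<psi> s n)"
        using w by (simp only: norm_mult) (intro mult_right_mono, auto)
    qed
    also note step.IH
    finally show ?case
      using step by (simp add: algebra_simps)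
  qed
  have "norm (\<phi> s n - \<psi> s n) \<le> (real (i * m) + real m * (K * B)) * \<bar>s\<bar>" if "n \<ge> i" for s n
  proof -
    have "real m * (\<bar>s\<bar> * (K * (\<Sum>r = i..<n. sqrt (real r) / real r ^ 2))) \<le> real m * (\<bar>s\<bar> * (K * B))"
      using B[of n] by (intro mult_left_mono) (auto simp: B_def K_def)
    then show ?thesis
      using step[OF that, of s] by (simp add: algebra_simps)
  qed
  then show ?thesis
    unfolding \<phi>_def \<psi>_def by blast
qed

section \<open>Central limit theorem and law of large numbers for one vertex\<close>

lemma measurable_normalised_degree [measurable]:
  "(\<lambda>\<omega>. (real (dpa_degree m (T \<omega>) n i) - a) / b) \<in> borel_measurable M"
  using measurable_compose[OF measurable_degree, of "\<lambda>d. (real d - a) / b" borel n i] by simp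

text \<open>By Levy's theorem it suffices to treat characteristic functions. Centring multiplies
  them by a factor of modulus 1, so the Poisson approximation holds up to C |s| with s = t / sqrt (m
  log n), which tends to 0.\<close>

theorem degree_CLT:
  assumes "i \<ge> 1"
  shows "weak_conv_m
        (\<lambda>n. distr M borel (\<lambda>\<omega>.
          (real (dpa_degree m (T \<omega>) n i) - real m * ln (real n)) / sqrt (real m * ln (real n))))
        std_normal_distribution"
proof (rule levy_continuity)
  fix t :: real
  obtain c where L: "(\<lambda>n. (\<Sum>r = i..<n. 1 / real r) - ln (real n)) \<longlonglongrightarrow> c"
    using reciprocal_sum_asymptotics[OF assms] by blast
  obtain C where C: "\<And>s n. n \<ge> i \<Longrightarrow> norm ((\<integral>\<omega>. iexp (s * real (dpa_degree m (T \<omega>) n i)) \<partial>M)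
      - exp (real m * (iexp s - 1) * (\<Sum>r = i..<n. 1 / real r))) \<le> C * \<bar>s\<bar>"
    using char_degree_approx[OF assms] by blast
  define \<mu> where "\<mu> = real m"
  define s where "s n = t / sqrt (\<mu> * ln (real n))" for n
  define X where "X = (\<lambda>n \<omega>. (real (dpa_degree m (T \<omega>) n i) - \<mu> * ln (real n)) / sqrt (\<mu> * ln (real n)))"
  have \<mu>: "\<mu> > 0"
    using m_ge by (simp add: \<mu>_def)
  define \<psi> where "\<psi> = (\<lambda>n. exp (\<mu> * (iexp (s n) - 1) * (\<Sum>r = i..<n. 1 / real r) - \<i> * s n * \<mu> * ln (real n)))"
  have "char (distr M borel (X n)) t
      = exp (- (\<i> * s n * \<mu> * ln (real n))) * (\<integral>\<omega>. iexp (s n * real (dpa_degree m (T \<omega>) n i)) \<partial>M)" for n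
  proof -
    have "char (distr M borel (X n)) t = (\<integral>\<omega>. iexp (t * X n \<omega>) \<partial>M)"
      unfolding char_def by (rule integral_distr) (auto simp: X_def)
    also have "\<dots> = (\<integral>\<omega>. exp (- (\<i> * s n * \<mu> * ln (real n))) * iexp (s n * real (dpa_degree m (T \<omega>) n i)) \<partial>M)"
    proof (intro Bochner_Integration.integral_cong refl)
      fix \<omega>
      have "t * X n \<omega> = s n * real (dpa_degree m (T \<omega>) n i) - s n * \<mu> * ln (real n)"
        by (simp add: X_def s_def diff_divide_distrib right_diff_distrib)
      then have "\<i> * complex_of_real (t * X n \<omega>) = - (\<i> * s n * \<mu> * ln (real n))
          + \<i> * complex_of_real (s n * real (dpa_degree m (T \<omega>) n i))"
        by (simp only: of_real_diff of_real_mult right_diff_distrib) simp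
      then show "iexp (t * X n \<omega>)
          = exp (- (\<i> * s n * \<mu> * ln (real n))) * iexp (s n * real (dpa_degree m (T \<omega>) n i))"
        by (simp only: exp_add)
    qed
    finally show ?thesis
      by simp
  qed
  then have diff: "char (distr M borel (X n)) t - \<psi> n = exp (- (\<i> * s n * \<mu> * ln (real n)))
      * ((\<integral>\<omega>. iexp (s n * real (dpa_degree m (T \<omega>) n i)) \<partial>M)
        - exp (\<mu> * (iexp (s n) - 1) * (\<Sum>r = i..<n. 1 / real r)))" for n
    unfolding right_diff_distrib[of "exp _"] exp_add[symmetric] \<psi>_def by (simp only: uminus_add_conv_diff)
  have nrm: "norm (exp (- (\<i> * s n * \<mu> * ln (real n)))) = 1" for n
    by simp
  have "\<forall>\<^sub>F n in sequentially. norm (char (distr M borel (X n)) t - \<psi> n) \<le> C * \<bar>s n\<bar>"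
    using eventually_ge_at_top[of i]
  proof eventually_elim
    case (elim n)
    show ?case
      unfolding diff norm_mult nrm mult_1_left using C[OF elim, of "s n"] by (simp only: \<mu>_def)
  qed
  moreover have "s \<longlonglongrightarrow> 0"
    unfolding s_def using \<mu> by real_asymp
  from tendsto_mult[OF tendsto_const[of C] tendsto_rabs[OF this]]
  have "(\<lambda>n. C * \<bar>s n\<bar>) \<longlonglongrightarrow> 0"
    by simp
  ultimately have "(\<lambda>n. char (distr M borel (X n)) t - \<psi> n) \<longlonglongrightarrow> 0"
    by (rule Lim_null_comparison)
  moreover have "\<psi> \<longlonglongrightarrow> complex_of_real (exp (- (t\<^sup>2) / 2))"
    using tendsto_exp_of_normalised_poisson[OF \<mu> L, of t] by (simp only: \<psi>_def s_def)
  ultimately have "(\<lambda>n. (char (distr M borel (X n)) t - \<psi> n) + \<psi> n) \<longlonglongrightarrow> 0 + complex_of_real (exp (- (t\<^sup>2) / 2))"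
    by (rule tendsto_add)
  then show "(\<lambda>n. char (distr M borel (\<lambda>\<omega>.
          (real (dpa_degree m (T \<omega>) n i) - real m * ln (real n)) / sqrt (real m * ln (real n)))) t)
      \<longlonglongrightarrow> char std_normal_distribution t"
    by (simp add: X_def \<mu>_def char_std_normal_distribution)
qed (intro real_dist_normal_dist real_distribution_distr measurable_normalised_degree)+

text \<open>The relative deviation times sqrt (m log n) is the normalised degree. The event thus
  says that a weakly convergent sequence exceeds \<epsilon> sqrt (m log n), which tends to
  infinity.\<close>

theorem degree_LLN:
  assumes "i \<ge> 1" "\<epsilon> > 0"
  shows "(\<lambda>n. measure M {\<omega> \<in> space M.
        \<bar>real (dpa_degree m (T \<omega>) n i) / (real m * ln (real n)) - 1\<bar> > \<epsilon>}) \<longlonglongrightarrow> 0"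
proof -
  define X where "X = (\<lambda>n \<omega>. (real (dpa_degree m (T \<omega>) n i) - real m * ln (real n)) / sqrt (real m * ln (real n)))"
  define c where "c n = \<epsilon> * sqrt (real m * ln (real n))" for n
  have "filterlim c at_top sequentially"
    unfolding c_def using assms m_ge by real_asymp
  then have "(\<lambda>n. measure (distr M borel (X n)) {x. \<bar>x\<bar> > c n}) \<longlonglongrightarrow> 0"
    using degree_CLT[OF assms(1)]
    by (intro weak_conv_m_tail[OF _ real_dist_normal_dist _ isCont_cdf_std_normal])
      (auto simp: X_def)
  moreover have "\<forall>\<^sub>F n in sequentially. measure (distr M borel (X n)) {x. \<bar>x\<bar> > c n}
      = measure M {\<omega> \<in> space M. \<bar>real (dpa_degree m (T \<omega>) n i) / (real m * ln (real n)) - 1\<bar> > \<epsilon>}"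
    using eventually_gt_at_top[of 1]
  proof eventually_elim
    case (elim n)
    define q where "q = sqrt (real m * ln (real n))"
    have q: "q > 0" "real m * ln (real n) = q * q"
      using elim m_ge by (auto simp: q_def)
    have eq: "X n \<omega> = q * (real (dpa_degree m (T \<omega>) n i) / (real m * ln (real n)) - 1)" for \<omega>
      unfolding X_def q_def[symmetric] q(2) using q(1) by (simp add: diff_divide_distrib right_diff_distrib)
    have "measure (distr M borel (X n)) {x. \<bar>x\<bar> > c n} = measure M {\<omega> \<in> space M. \<bar>X n \<omega>\<bar> > c n}"
      by (subst measure_distr) (auto simp: X_def intro!: arg_cong[where f = "measure M"])
    also have "{\<omega> \<in> space M. \<bar>X n \<omega>\<bar> > c n} =
        {\<omega> \<in> space M. \<bar>real (dpa_degree m (T \<omega>) n i) / (real m * ln (real n)) - 1\<bar> > \<epsilon>}"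
      unfolding eq c_def q_def[symmetric] abs_mult mult.commute[of \<epsilon> q] using q(1) by simp
    finally show ?case .
  qed
  ultimately show ?thesis
    by (rule Lim_transform_eventually)
qed

section \<open>The degree distribution for m = 1\<close>

lemma dpa_degree_Suc:
  assumes "m = 1" "j \<in> {1..n}"
  shows "dpa_degree m t (Suc n) j = dpa_degree m t n j + of_bool (t (Suc n) 1 = j)"
  using assms by (auto simp: dpa_degree_eq)

lemma dpa_degree_new:
  assumes "n \<ge> 1" "\<omega> \<in> space M"
  shows "dpa_degree m (T \<omega>) (Suc n) (Suc n) = m"
proof -
  have "T \<omega> r l \<noteq> Suc n" if "r \<in> {2..Suc n}" "l \<in> {1..m}" for r l
    using T_range[of \<omega> r l] that assms by auto
  then have "(\<Sum>r = 2..Suc n. \<Sum>l = 1..m. of_bool (T \<omega> r l = Suc n)) = (0::nat)"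
    by (intro sum.neutral ballI) simp
  then show ?thesis
    using assms by (simp add: dpa_degree_eq)
qed

lemma sum_target:
  assumes "n \<ge> 1" "\<omega> \<in> space M"
  shows "(\<Sum>j = 1..n. of_bool (T \<omega> (Suc n) 1 = j)) = (1 :: 'b :: semiring_1)"
  using T_range[of \<omega> "Suc n" 1] assms m_ge
  by (subst sum.cong[OF refl, of _ _ "\<lambda>j. if T \<omega> (Suc n) 1 = j then 1 else 0"]) auto

text \<open>Each step adds one at the vertex hit and one for the new vertex; the initial 1 is the
  half-edge carried by the first vertex.\<close>

lemma sum_degree:
  assumes "m = 1" "n \<ge> 1" "\<omega> \<in> space M"
  shows "(\<Sum>j = 1..n. dpa_degree m (T \<omega>) n j) = 2 * n - 1"
  using assms(2)
proof (induction n rule: dec_induct)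
  case base
  then show ?case
    using assms by (simp add: dpa_degree_eq)
next
  case (step n)
  have "(\<Sum>j = 1..Suc n. dpa_degree m (T \<omega>) (Suc n) j)
      = (\<Sum>j = 1..n. dpa_degree m (T \<omega>) (Suc n) j) + dpa_degree m (T \<omega>) (Suc n) (Suc n)"
    by simp
  also have "\<dots> = (\<Sum>j = 1..n. dpa_degree m (T \<omega>) n j + of_bool (T \<omega> (Suc n) 1 = j)) + m"
    using step assms
    by (intro arg_cong2[where f = "(+)"] sum.cong refl dpa_degree_Suc dpa_degree_new) auto
  also have "\<dots> = 2 * n - 1 + 1 + 1"
    unfolding sum.distrib step.IH sum_target[OF step.hyps(1) assms(3)] using assms by simp
  finally show ?case
    using step by simp
qed

section \<open>Degree counts, hits and their conditional probabilities\<close>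

definition deg_count :: "nat \<Rightarrow> nat \<Rightarrow> 'a \<Rightarrow> real" where
  "deg_count n k \<omega> = (\<Sum>j = 1..n. of_bool (dpa_degree m (T \<omega>) n j = k))"

text \<open>
  The value at \<open>k = 0\<close> is set to \<open>0\<close> so that one recursion covers all degrees, including \<open>1\<close>.
\<close>

definition deg_dev :: "nat \<Rightarrow> nat \<Rightarrow> 'a \<Rightarrow> real" where
  "deg_dev n k \<omega> = (if k = 0 then 0 else deg_count n k \<omega> - real n / 2 ^ k)"

text \<open>The indicator that the first half-edge of the new vertex goes to a vertex of degree k.
  As a sum over vertices it can be conditioned term by term.\<close>

definition hit :: "nat \<Rightarrow> nat \<Rightarrow> 'a \<Rightarrow> real" where
  "hit n k \<omega> = (\<Sum>j = 1..n. of_bool (dpa_degree m (T \<omega>) n j = k) * of_bool (T \<omega> (Suc n) 1 = j))"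

text \<open>A version of the conditional expectation of \<open>hit n k\<close> given
  \<open>filt n 0\<close>.\<close>

definition hit_prob :: "nat \<Rightarrow> nat \<Rightarrow> 'a \<Rightarrow> real" where
  "hit_prob n k \<omega> =
    (\<Sum>j = 1..n. of_bool (dpa_degree m (T \<omega>) n j = k) * dpa_prob \<alpha> \<theta> m (T \<omega>) n 0 j)"

lemma measurable_of_bool_degree_filt:
  "(\<lambda>\<omega>. of_bool (dpa_degree m (T \<omega>) n j = k) :: real) \<in> borel_measurable (filt n 0)"
  using measurable_compose[OF measurable_degree_filt, of "\<lambda>d. of_bool (d = k) :: real" borel] by simp

lemma measurable_deg_dev_filt: "(\<lambda>\<omega>. deg_dev n k \<omega>) \<in> borel_measurable (filt n 0)"
proof (cases "k = 0")
  case False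
  have "(\<lambda>\<omega>. deg_count n k \<omega> - real n / 2 ^ k) \<in> borel_measurable (filt n 0)"
    unfolding deg_count_def
    by (intro borel_measurable_diff borel_measurable_sum measurable_of_bool_degree_filt borel_measurable_const)
  then show ?thesis
    using False by (simp add: deg_dev_def)
qed (simp add: deg_dev_def)

lemma measurable_of_bool_degree [measurable]:
  "(\<lambda>\<omega>. of_bool (dpa_degree m (T \<omega>) n j = k) :: real) \<in> borel_measurable M"
  using measurable_compose[OF measurable_degree, of "\<lambda>d. of_bool (d = k) :: real" borel] by simp

lemma measurable_of_bool_target:
  assumes "n \<ge> 1"
  shows "(\<lambda>\<omega>. of_bool (T \<omega> (Suc n) 1 = j) :: real) \<in> borel_measurable M"
  using measurable_compose[OF measurable_target[of n 0], of "\<lambda>d. of_bool (d = j) :: real" borel] assms m_ge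
  by simp

lemma measurable_deg_count [measurable]: "deg_count n k \<in> borel_measurable M"
  unfolding deg_count_def by measurable

lemma measurable_deg_dev [measurable]: "deg_dev n k \<in> borel_measurable M"
  unfolding deg_dev_def by measurable

lemma measurable_hit: "n \<ge> 1 \<Longrightarrow> hit n k \<in> borel_measurable M"
  unfolding hit_def
  by (intro borel_measurable_sum borel_measurable_times measurable_of_bool_degree measurable_of_bool_target)

lemma measurable_dpa_prob: "n \<ge> 1 \<Longrightarrow> (\<lambda>\<omega>. dpa_prob \<alpha> \<theta> m (T \<omega>) n 0 j) \<in> borel_measurable M"
  by (rule measurable_from_subalg[OF subalgebra_filt dpa_prob_measurable]) auto

lemma measurable_hit_prob: "n \<ge> 1 \<Longrightarrow> hit_prob n k \<in> borel_measurable M"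
  unfolding hit_prob_def
  by (intro borel_measurable_sum borel_measurable_times measurable_of_bool_degree measurable_dpa_prob)

lemma deg_count_bounds: "0 \<le> deg_count n k \<omega>" "deg_count n k \<omega> \<le> real n"
proof -
  show "0 \<le> deg_count n k \<omega>"
    unfolding deg_count_def by (intro sum_nonneg) auto
  have "deg_count n k \<omega> \<le> (\<Sum>j = 1..n. 1)"
    unfolding deg_count_def by (intro sum_mono) auto
  then show "deg_count n k \<omega> \<le> real n"
    by simp
qed

lemma abs_deg_dev_le: "\<bar>deg_dev n k \<omega>\<bar> \<le> real n"
proof (cases "k = 0")
  case False
  have "real n / 2 ^ k \<le> real n / 1"
    by (intro divide_left_mono) auto
  moreover have "0 \<le> real n / 2 ^ k"
    by simp
  ultimately show ?thesis
    unfolding deg_dev_def if_not_P[OF False] using deg_count_bounds[of n k \<omega>] by linarith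
qed (simp add: deg_dev_def)

lemma deg_count_0: "deg_count n 0 \<omega> = 0"
proof -
  have "dpa_degree m (T \<omega>) n j \<noteq> 0" if "j \<in> {1..n}" for j
    using dpa_degree_ge[OF that, of m "T \<omega>"] m_ge by simp
  then show ?thesis
    unfolding deg_count_def by (intro sum.neutral) simp
qed

lemma hit_nonneg: "0 \<le> hit n k \<omega>"
  unfolding hit_def by (intro sum_nonneg) auto

lemma sum_hit_le:
  assumes "n \<ge> 1" "\<omega> \<in> space M" "finite A"
  shows "(\<Sum>k\<in>A. hit n k \<omega>) \<le> 1"
proof -
  have "(\<Sum>k\<in>A. hit n k \<omega>)
      = (\<Sum>j = 1..n. (\<Sum>k\<in>A. of_bool (dpa_degree m (T \<omega>) n j = k)) * of_bool (T \<omega> (Suc n) 1 = j))"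
    unfolding hit_def by (subst sum.swap) (simp only: sum_distrib_right)
  also have "\<dots> \<le> (\<Sum>j = 1..n. 1 * of_bool (T \<omega> (Suc n) 1 = j))"
    using sum_of_bool_eq_le_1[OF assms(3)] by (intro sum_mono mult_right_mono) auto
  also have "\<dots> = 1"
    using sum_target[OF assms(1,2)] by (simp only: mult_1_left)
  finally show ?thesis .
qed

lemma hit_le_1:
  assumes "n \<ge> 1" "\<omega> \<in> space M"
  shows "hit n k \<omega> \<le> 1"
  using sum_hit_le[OF assms, of "{k}"] by simp

text \<open>Vertex j contributes an error of at most 2 (1 + d)/n^2 with d its degree, and only to
  the one class k = d. The degrees sum to 2n - 1, so the total is at most 2 (n + 2n)/n^2 for every
  finite set of classes at once.\<close>

lemma sum_hit_prob_approx:
  assumes "m = 1" "n \<ge> 1" "\<omega> \<in> space M" "finite A"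
  shows "(\<Sum>k\<in>A. \<bar>hit_prob n k \<omega> - deg_count n k \<omega> / real n\<bar>) \<le> 6 / real n"
proof -
  let ?d = "\<lambda>j. dpa_degree m (T \<omega>) n j"
  have m: "0 < m"
    using m_ge by simp
  have "(\<Sum>k\<in>A. \<bar>hit_prob n k \<omega> - deg_count n k \<omega> / real n\<bar>)
      \<le> (\<Sum>k\<in>A. \<Sum>j = 1..n. of_bool (?d j = k) * (2 / real n ^ 2 * (1 + real (?d j))))"
  proof (rule sum_mono)
    fix k
    have eq: "hit_prob n k \<omega> - deg_count n k \<omega> / real n
        = (\<Sum>j = 1..n. of_bool (?d j = k) * (dpa_prob \<alpha> \<theta> m (T \<omega>) n 0 j - 1 / real n))"
      unfolding hit_prob_def deg_count_def sum_divide_distrib right_diff_distrib sum_subtractf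
      by (simp only: times_divide_eq_right mult_1_right)
    have "\<bar>hit_prob n k \<omega> - deg_count n k \<omega> / real n\<bar>
        \<le> (\<Sum>j = 1..n. \<bar>of_bool (?d j = k) * (dpa_prob \<alpha> \<theta> m (T \<omega>) n 0 j - 1 / real n)\<bar>)"
      unfolding eq by (rule sum_abs)
    also have "\<dots> \<le> (\<Sum>j = 1..n. of_bool (?d j = k) * (2 / real n ^ 2 * (1 + real (?d j))))"
    proof (rule sum_mono)
      fix j assume j: "j \<in> {1..n}"
      have "\<bar>dpa_prob \<alpha> \<theta> m (T \<omega>) n 0 j - 1 / real n\<bar> \<le> 2 / real n ^ 2 * (1 + real (?d j))"
        using dpa_prob_approx[OF assms(2) m j, of \<omega>] by (simp only: dpa_degree_step_0 times_divide_eq_left)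
      then show "\<bar>of_bool (?d j = k) * (dpa_prob \<alpha> \<theta> m (T \<omega>) n 0 j - 1 / real n)\<bar>
          \<le> of_bool (?d j = k) * (2 / real n ^ 2 * (1 + real (?d j)))"
        unfolding abs_mult abs_bool_eq by (rule mult_left_mono) simp
    qed
    finally show "\<bar>hit_prob n k \<omega> - deg_count n k \<omega> / real n\<bar>
        \<le> (\<Sum>j = 1..n. of_bool (?d j = k) * (2 / real n ^ 2 * (1 + real (?d j))))" .
  qed
  also have "\<dots> = (\<Sum>j = 1..n. (\<Sum>k\<in>A. of_bool (?d j = k)) * (2 / real n ^ 2 * (1 + real (?d j))))"
    by (subst sum.swap) (simp only: sum_distrib_right)
  also have "\<dots> \<le> (\<Sum>j = 1..n. 1 * (2 / real n ^ 2 * (1 + real (?d j))))"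
    using sum_of_bool_eq_le_1[OF assms(4)] by (intro sum_mono mult_right_mono) auto
  also have "\<dots> = 2 / real n ^ 2 * (real n + real (\<Sum>j = 1..n. ?d j))"
    unfolding mult_1_left sum_distrib_left[symmetric] by (simp add: sum.distrib)
  also have "\<dots> \<le> 2 / real n ^ 2 * (real n + 2 * real n)"
    unfolding sum_degree[OF assms(1-3)] by (intro mult_left_mono) auto
  also have "\<dots> = 6 / real n"
    using assms by (simp add: power2_eq_square)
  finally show ?thesis .
qed

lemma hit_prob_approx:
  assumes "m = 1" "n \<ge> 1" "\<omega> \<in> space M"
  shows "\<bar>hit_prob n k \<omega> - deg_count n k \<omega> / real n\<bar> \<le> 6 / real n"
  using sum_hit_prob_approx[OF assms, of "{k}"] by simp

lemma hit_prob_bound: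
  assumes "m = 1" "n \<ge> 1" "\<omega> \<in> space M"
  shows "\<bar>hit_prob n k \<omega>\<bar> \<le> 7"
proof -
  have "6 / real n \<le> 6 / 1"
    using assms(2) by (intro divide_left_mono) auto
  moreover have "deg_count n k \<omega> / real n \<le> 1" "0 \<le> deg_count n k \<omega> / real n"
    using assms(2) deg_count_bounds[of n k \<omega>] by simp_all
  ultimately show ?thesis
    using hit_prob_approx[OF assms, of k] by linarith
qed

lemma integrable_bounded:
  fixes f :: "'a \<Rightarrow> real"
  assumes "f \<in> borel_measurable M" "\<And>\<omega>. \<omega> \<in> space M \<Longrightarrow> \<bar>f \<omega>\<bar> \<le> B"
  shows "integrable M f"
  using assms by (intro integrable_const_bound[where B = B] AE_I2) auto

text \<open>\<open>expectation_target\<close> is summed over the vertices: W times the indicator of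
  having degree k is itself known before the attachment.\<close>

lemma expectation_hit:
  assumes "n \<ge> 1" "W \<in> borel_measurable (filt n 0)" "\<And>\<omega>. \<bar>W \<omega>\<bar> \<le> B"
  shows "(\<integral>\<omega>. W \<omega> * hit n k \<omega> \<partial>M) = (\<integral>\<omega>. W \<omega> * hit_prob n k \<omega> \<partial>M)"
proof -
  let ?I = "\<lambda>\<omega> j. of_bool (dpa_degree m (T \<omega>) n j = k) :: real"
  have m: "0 < m"
    using m_ge by simp
  have WI: "(\<lambda>\<omega>. W \<omega> * ?I \<omega> j) \<in> borel_measurable (filt n 0)" for j
    by (intro borel_measurable_times assms measurable_of_bool_degree_filt)
  have WM: "W \<in> borel_measurable M"
    using measurable_from_subalg[OF subalgebra_filt assms(2)] assms(1) by simp
  have Wb: "\<bar>W \<omega> * ?I \<omega> j\<bar> \<le> B" for \<omega> j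
    using assms(3)[of \<omega>] by (auto simp: abs_mult intro: order_trans[OF abs_ge_zero])
  have int1: "integrable M (\<lambda>\<omega>. (W \<omega> * ?I \<omega> j) * of_bool (T \<omega> (Suc n) 1 = j))" for j
    using assms(1) by (intro integrable_bounded[where B = "B * 1"] borel_measurable_times WM
      measurable_of_bool_degree       measurable_of_bool_target abs_mult_le Wb) auto
  have int2: "integrable M (\<lambda>\<omega>. (W \<omega> * ?I \<omega> j) * dpa_prob \<alpha> \<theta> m (T \<omega>) n 0 j)" if "j \<in> {1..n}" for j
  proof (intro integrable_bounded[where B = "B * (1 / real n + 2 * (1 + real (n * m)) / real n ^ 2)"]
      borel_measurable_times WM measurable_of_bool_degree measurable_dpa_prob assms abs_mult_le Wb)
    fix \<omega>
    have "2 * (1 + real (dpa_degree m (T \<omega>) n j)) / real n ^ 2 \<le> 2 * (1 + real (n * m)) / real n ^ 2"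
      using dpa_degree_le[OF assms(1), of m "T \<omega>" j]
      by (intro divide_right_mono mult_left_mono add_left_mono) (simp_all del: of_nat_mult)
    then have "\<bar>dpa_prob \<alpha> \<theta> m (T \<omega>) n 0 j - 1 / real n\<bar> \<le> 2 * (1 + real (n * m)) / real n ^ 2"
      using dpa_prob_approx[OF assms(1) m that, of \<omega>] unfolding dpa_degree_step_0 by linarith
    then show "\<bar>dpa_prob \<alpha> \<theta> m (T \<omega>) n 0 j\<bar> \<le> 1 / real n + 2 * (1 + real (n * m)) / real n ^ 2"
      using divide_nonneg_nonneg[of 1 "real n"] by linarith
  qed
  have "(\<integral>\<omega>. W \<omega> * hit n k \<omega> \<partial>M)
      = (\<integral>\<omega>. (\<Sum>j = 1..n. (W \<omega> * ?I \<omega> j) * of_bool (T \<omega> (Suc n) 1 = j)) \<partial>M)"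
    by (simp only: hit_def sum_distrib_left mult.assoc)
  also have "\<dots> = (\<Sum>j = 1..n. \<integral>\<omega>. (W \<omega> * ?I \<omega> j) * of_bool (T \<omega> (Suc n) 1 = j) \<partial>M)"
    by (intro Bochner_Integration.integral_sum int1)
  also have "\<dots> = (\<Sum>j = 1..n. \<integral>\<omega>. (W \<omega> * ?I \<omega> j) * dpa_prob \<alpha> \<theta> m (T \<omega>) n 0 j \<partial>M)"
    using expectation_target[OF assms(1) m _ WI Wb] by (intro sum.cong refl) simp
  also have "\<dots> = (\<integral>\<omega>. (\<Sum>j = 1..n. (W \<omega> * ?I \<omega> j) * dpa_prob \<alpha> \<theta> m (T \<omega>) n 0 j) \<partial>M)"
    by (intro Bochner_Integration.integral_sum[symmetric] int2)
  also have "\<dots> = (\<integral>\<omega>. W \<omega> * hit_prob n k \<omega> \<partial>M)"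
    by (simp only: hit_prob_def sum_distrib_left mult.assoc)
  finally show ?thesis .
qed

section \<open>One step of the deviation vector\<close>

text \<open>The vertex hit moves up by one degree class, and the new vertex enters class 1.\<close>

lemma deg_count_Suc:
  assumes "m = 1" "n \<ge> 1" "\<omega> \<in> space M"
  shows "deg_count (Suc n) (Suc k) \<omega>
    = deg_count n (Suc k) \<omega> + of_bool (k = 0) + hit n k \<omega> - hit n (Suc k) \<omega>"
proof -
  have "deg_count (Suc n) (Suc k) \<omega>
      = (\<Sum>j = 1..n. of_bool (dpa_degree m (T \<omega>) (Suc n) j = Suc k))
        + of_bool (dpa_degree m (T \<omega>) (Suc n) (Suc n) = Suc k)"
    by (simp add: deg_count_def del: sum_of_bool_eq)
  also have "of_bool (dpa_degree m (T \<omega>) (Suc n) (Suc n) = Suc k) = (of_bool (k = 0) :: real)"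
    unfolding dpa_degree_new[OF assms(2,3)] using assms(1) by auto
  also have "(\<Sum>j = 1..n. of_bool (dpa_degree m (T \<omega>) (Suc n) j = Suc k))
      = (\<Sum>j = 1..n. of_bool (dpa_degree m (T \<omega>) n j = Suc k)
        + of_bool (dpa_degree m (T \<omega>) n j = k) * of_bool (T \<omega> (Suc n) 1 = j)
        - of_bool (dpa_degree m (T \<omega>) n j = Suc k) * of_bool (T \<omega> (Suc n) 1 = j) :: real)"
    by (intro sum.cong refl) (simp only: dpa_degree_Suc[OF assms(1)], simp)
  also have "\<dots> = deg_count n (Suc k) \<omega> + hit n k \<omega> - hit n (Suc k) \<omega>"
    by (simp only: sum.distrib sum_subtractf deg_count_def hit_def)
  finally show ?thesis
    by simp
qed

text \<open>The change of \<open>deg_dev\<close> at index \<open>Suc k\<close>. The first term is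
  the new vertex, the second the growth of n/2^(k+1).\<close>

definition incr :: "nat \<Rightarrow> nat \<Rightarrow> 'a \<Rightarrow> real" where
  "incr n k \<omega> = of_bool (k = 0) - 1 / 2 ^ Suc k + hit n k \<omega> - hit n (Suc k) \<omega>"

text \<open>The conditional mean of \<open>incr n k\<close> given \<open>filt n 0\<close>.\<close>

definition drift :: "nat \<Rightarrow> nat \<Rightarrow> 'a \<Rightarrow> real" where
  "drift n k \<omega> = of_bool (k = 0) - 1 / 2 ^ Suc k + hit_prob n k \<omega> - hit_prob n (Suc k) \<omega>"

lemma deg_dev_Suc:
  assumes "m = 1" "n \<ge> 1" "\<omega> \<in> space M"
  shows "deg_dev (Suc n) (Suc k) \<omega> = deg_dev n (Suc k) \<omega> + incr n k \<omega>"
  using deg_count_Suc[OF assms, of k] by (simp add: deg_dev_def incr_def add_divide_distrib)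

lemma abs_incr_le:
  "\<bar>incr n k \<omega>\<bar> \<le> of_bool (k = 0) + 1 / 2 ^ Suc k + hit n k \<omega> + hit n (Suc k) \<omega>"
proof -
  have "0 \<le> (1 :: real) / 2 ^ Suc k"
    by simp
  moreover have "0 \<le> (of_bool (k = 0) :: real)"
    by simp
  ultimately show ?thesis
    unfolding incr_def using hit_nonneg[of n k \<omega>] hit_nonneg[of n "Suc k" \<omega>] by linarith
qed

lemma abs_incr_le_2:
  assumes "n \<ge> 1" "\<omega> \<in> space M"
  shows "\<bar>incr n k \<omega>\<bar> \<le> 2"
proof -
  have "0 \<le> (1 :: real) / 2 ^ Suc k" "(1 :: real) / 2 ^ Suc k \<le> 1"
    using one_le_power[of "2 :: real" "Suc k"] by simp_all
  moreover have "0 \<le> (of_bool (k = 0) :: real)" "(of_bool (k = 0) :: real) \<le> 1"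
    by simp_all
  ultimately show ?thesis
    unfolding incr_def using hit_nonneg[of n k \<omega>] hit_nonneg[of n "Suc k" \<omega>]
      hit_le_1[OF assms, of k] hit_le_1[OF assms, of "Suc k"] by linarith
qed

text \<open>Every entry is at most 2 in absolute value and the l1-norm is at most 4: one each from
  the new vertex, the geometric weights and the two hit terms.\<close>

lemma sum_incr_sq_le:
  assumes "n \<ge> 1" "\<omega> \<in> space M"
  shows "(\<Sum>k<K. (incr n k \<omega>)\<^sup>2) \<le> 8"
proof -
  have "(\<Sum>k<K. (incr n k \<omega>)\<^sup>2)
      \<le> (\<Sum>k<K. 2 * (of_bool (k = 0) + 1 / 2 ^ Suc k + hit n k \<omega> + hit n (Suc k) \<omega>))"
  proof (rule sum_mono)
    fix k
    have "(incr n k \<omega>)\<^sup>2 = \<bar>incr n k \<omega>\<bar> * \<bar>incr n k \<omega>\<bar>"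
      by (simp add: power2_eq_square)
    also have "\<dots> \<le> 2 * (of_bool (k = 0) + 1 / 2 ^ Suc k + hit n k \<omega> + hit n (Suc k) \<omega>)"
      using abs_incr_le_2[OF assms, of k] abs_incr_le[of n k \<omega>] by (intro mult_mono) auto
    finally show "(incr n k \<omega>)\<^sup>2 \<le> 2 * (of_bool (k = 0) + 1 / 2 ^ Suc k + hit n k \<omega> + hit n (Suc k) \<omega>)" .
  qed
  also have "\<dots> = 2 * ((\<Sum>k<K. of_bool (0 = k)) + (\<Sum>k<K. 1 / 2 ^ Suc k)
      + (\<Sum>k<K. hit n k \<omega>) + (\<Sum>k<K. hit n (Suc k) \<omega>))"
    by (simp only: sum_distrib_left sum.distrib distrib_left eq_commute[of "0 :: nat"])
  also have "(\<Sum>k<K. hit n (Suc k) \<omega>) = (\<Sum>k\<in>Suc ` {..<K}. hit n k \<omega>)"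
    by (simp add: sum.reindex)
  finally show ?thesis
    using sum_of_bool_eq_le_1[of "{..<K}" 0] sum_half_powers_le[of K]
      sum_hit_le[OF assms, of "{..<K}"] sum_hit_le[OF assms, of "Suc ` {..<K}"] by simp
qed

text \<open>
  The drift of the deviation vector is \<open>(S - I) X / n\<close> with \<open>S\<close> the shift, up to a small error; as
  \<open>S\<close> is a contraction in the Euclidean norm, the inner product with \<open>X\<close> stays bounded.
\<close>

lemma sum_dev_drift_le:
  assumes "m = 1" "n \<ge> 1" "\<omega> \<in> space M"
  shows "(\<Sum>k<K. 2 * (deg_dev n (Suc k) \<omega> * drift n k \<omega>)) \<le> 24"
proof -
  define X where "X k = deg_dev n k \<omega>" for k
  define R where "R k = hit_prob n k \<omega> - deg_count n k \<omega> / real n" for k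
  have n: "real n > 0"
    using assms by simp
  \<comment> \<open>The weights 2^(-k) cancel because 2^(-k) - 2^(-k-1) = 2^(-k-1). At k = 0 the
    conventions X 0 = 0 and \<open>deg_count_0\<close> apply, and the new vertex supplies the
    missing weight 1.\<close>
  have drift: "drift n k \<omega> = (X k - X (Suc k)) / real n + (R k - R (Suc k))" for k
    using n by (cases "k = 0")
      (simp_all add: drift_def X_def R_def deg_dev_def deg_count_0 field_simps)
  have R: "(\<Sum>k\<in>A. \<bar>R k\<bar>) \<le> 6 / real n" if "finite A" for A
    unfolding R_def by (rule sum_hit_prob_approx[OF assms that])
  have "(\<Sum>k<K. 2 * (X (Suc k) * drift n k \<omega>))
      \<le> (\<Sum>k<K. ((X k)\<^sup>2 - (X (Suc k))\<^sup>2) / real n + 2 * real n * (\<bar>R k\<bar> + \<bar>R (Suc k)\<bar>))"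
  proof (rule sum_mono)
    fix k
    \<comment> \<open>The contraction property in termwise form: 2b (a - b) \<le> a^2 - b^2, whose
      right-hand side telescopes.\<close>
    have "0 \<le> (X k - X (Suc k))\<^sup>2"
      by simp
    then have "2 * X (Suc k) * (X k - X (Suc k)) \<le> (X k)\<^sup>2 - (X (Suc k))\<^sup>2"
      by (simp add: power2_eq_square algebra_simps)
    then have 1: "2 * X (Suc k) * (X k - X (Suc k)) / real n \<le> ((X k)\<^sup>2 - (X (Suc k))\<^sup>2) / real n"
      by (rule divide_right_mono) simp
    \<comment> \<open>The trivial bound |X| \<le> n suffices, since the l1-norm of R is at most
      6/n.\<close>
    have "X (Suc k) * (R k - R (Suc k)) \<le> \<bar>X (Suc k) * (R k - R (Suc k))\<bar>"
      by (rule abs_ge_self)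
    also have "\<dots> \<le> real n * (\<bar>R k\<bar> + \<bar>R (Suc k)\<bar>)"
      using abs_deg_dev_le[of n "Suc k" \<omega>] abs_triangle_ineq4[of "R k" "R (Suc k)"]
      by (intro abs_mult_le) (simp_all add: X_def)
    finally have 2: "X (Suc k) * (R k - R (Suc k)) \<le> real n * (\<bar>R k\<bar> + \<bar>R (Suc k)\<bar>)" .
    have "2 * (X (Suc k) * drift n k \<omega>)
        = 2 * X (Suc k) * (X k - X (Suc k)) / real n + 2 * (X (Suc k) * (R k - R (Suc k)))"
      by (simp add: drift algebra_simps)
    with 1 2 show "2 * (X (Suc k) * drift n k \<omega>)
        \<le> ((X k)\<^sup>2 - (X (Suc k))\<^sup>2) / real n + 2 * real n * (\<bar>R k\<bar> + \<bar>R (Suc k)\<bar>)"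
      by linarith
  qed
  also have "\<dots> = (\<Sum>k<K. (X k)\<^sup>2 - (X (Suc k))\<^sup>2) / real n
      + 2 * real n * ((\<Sum>k<K. \<bar>R k\<bar>) + (\<Sum>k<K. \<bar>R (Suc k)\<bar>))"
    by (simp only: sum.distrib sum_divide_distrib sum_distrib_left distrib_left)
  \<comment> \<open>Because X 0 = 0, telescoping leaves only a nonpositive term, which is dropped
    afterwards.\<close>
  also have "(\<Sum>k<K. (X k)\<^sup>2 - (X (Suc k))\<^sup>2) = - (X K)\<^sup>2"
    by (subst sum_lessThan_telescope') (simp add: X_def deg_dev_def)
  also have "(\<Sum>k<K. \<bar>R (Suc k)\<bar>) = (\<Sum>k\<in>Suc ` {..<K}. \<bar>R k\<bar>)"
    by (simp add: sum.reindex)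
  also have "- (X K)\<^sup>2 / real n + 2 * real n * ((\<Sum>k<K. \<bar>R k\<bar>) + (\<Sum>k\<in>Suc ` {..<K}. \<bar>R k\<bar>))
      \<le> 0 + 2 * real n * (6 / real n + 6 / real n)"
    using R by (intro add_mono mult_left_mono) auto
  also have "\<dots> = 24"
    using n by simp
  finally show ?thesis
    by (simp only: X_def)
qed

section \<open>Second moment of the deviation vector\<close>

text \<open>The deviation is known before the attachment, so the increment may be replaced by its
  conditional mean.\<close>

lemma expectation_dev_incr:
  assumes "m = 1" "n \<ge> 1"
  shows "integrable M (\<lambda>\<omega>. deg_dev n (Suc k) \<omega> * incr n k \<omega>)"
    and "integrable M (\<lambda>\<omega>. deg_dev n (Suc k) \<omega> * drift n k \<omega>)"
    and "(\<integral>\<omega>. deg_dev n (Suc k) \<omega> * incr n k \<omega> \<partial>M) = (\<integral>\<omega>. deg_dev n (Suc k) \<omega> * drift n k \<omega> \<partial>M)"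
proof -
  define X where "X = deg_dev n (Suc k)"
  define c :: real where "c = of_bool (k = 0) - 1 / 2 ^ Suc k"
  have int: "integrable M X"
    unfolding X_def by (rule integrable_bounded[OF measurable_deg_dev abs_deg_dev_le])
  have inth: "integrable M (\<lambda>\<omega>. X \<omega> * hit n l \<omega>)" for l
    unfolding X_def using assms hit_nonneg hit_le_1
    by (intro integrable_bounded[where B = "real n * 1"] borel_measurable_times measurable_deg_dev
      measurable_hit abs_mult_le abs_deg_dev_le) auto
  have intp: "integrable M (\<lambda>\<omega>. X \<omega> * hit_prob n l \<omega>)" for l
    unfolding X_def using assms
    by (intro integrable_bounded[where B = "real n * 7"] borel_measurable_times measurable_deg_dev
      measurable_hit_prob abs_mult_le abs_deg_dev_le hit_prob_bound) auto
  have eq: "(\<integral>\<omega>. X \<omega> * hit n l \<omega> \<partial>M) = (\<integral>\<omega>. X \<omega> * hit_prob n l \<omega> \<partial>M)" for l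
    unfolding X_def by (rule expectation_hit[OF assms(2) measurable_deg_dev_filt abs_deg_dev_le])
  have incr: "X \<omega> * incr n k \<omega> = X \<omega> * c + X \<omega> * hit n k \<omega> - X \<omega> * hit n (Suc k) \<omega>" for \<omega>
    by (simp add: incr_def c_def algebra_simps)
  have drift: "X \<omega> * drift n k \<omega> = X \<omega> * c + X \<omega> * hit_prob n k \<omega> - X \<omega> * hit_prob n (Suc k) \<omega>" for \<omega>
    by (simp add: drift_def c_def algebra_simps)
  show "integrable M (\<lambda>\<omega>. deg_dev n (Suc k) \<omega> * incr n k \<omega>)"
    unfolding X_def[symmetric] incr using int inth by simp
  show "integrable M (\<lambda>\<omega>. deg_dev n (Suc k) \<omega> * drift n k \<omega>)"
    unfolding X_def[symmetric] drift using int intp by simp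
  show "(\<integral>\<omega>. deg_dev n (Suc k) \<omega> * incr n k \<omega> \<partial>M) = (\<integral>\<omega>. deg_dev n (Suc k) \<omega> * drift n k \<omega> \<partial>M)"
    unfolding X_def[symmetric] incr drift using int inth intp eq by simp
qed

lemma integrable_deg_dev_sq: "integrable M (\<lambda>\<omega>. (deg_dev n k \<omega>)\<^sup>2)"
  unfolding power2_eq_square
  by (intro integrable_bounded[where B = "real n * real n"] borel_measurable_times
      measurable_deg_dev abs_mult_le abs_deg_dev_le)

text \<open>Expanding the square of X plus its increment, the cross term has expectation at most 24
  and the squared increments sum to at most 8, so each step adds at most 32. The bound is uniform in
  K.\<close>

lemma expectation_sum_dev_sq_le:
  assumes "m = 1" "n \<ge> 1"
  shows "(\<integral>\<omega>. (\<Sum>k<K. (deg_dev n (Suc k) \<omega>)\<^sup>2) \<partial>M) \<le> 32 * real n"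
  using assms(2)
proof (induction n rule: dec_induct)
  case base
  have "(\<Sum>k<K. (deg_dev 1 (Suc k) \<omega>)\<^sup>2) \<le> 32" for \<omega>
  proof -
    have "(\<Sum>k<K. (deg_dev 1 (Suc k) \<omega>)\<^sup>2) \<le> (\<Sum>k<K. of_bool (0 = k) + 1 / 2 ^ Suc k)"
    proof (rule sum_mono)
      fix k
      have "(deg_dev 1 (Suc k) \<omega>)\<^sup>2 = \<bar>deg_dev 1 (Suc k) \<omega>\<bar> * \<bar>deg_dev 1 (Suc k) \<omega>\<bar>"
        by (simp add: power2_eq_square)
      also have "\<dots> \<le> 1 * \<bar>deg_dev 1 (Suc k) \<omega>\<bar>"
        using abs_deg_dev_le[of 1 "Suc k" \<omega>] by (intro mult_right_mono) auto
      also have "\<dots> \<le> of_bool (0 = k) + 1 / 2 ^ Suc k"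
      proof -
        have "deg_count 1 (Suc k) \<omega> = of_bool (0 = k)"
          unfolding deg_count_def dpa_degree_eq using assms(1) by auto
        then show ?thesis
          by (auto simp: deg_dev_def)
      qed
      finally show "(deg_dev 1 (Suc k) \<omega>)\<^sup>2 \<le> of_bool (0 = k) + 1 / 2 ^ Suc k" .
    qed
    also have "\<dots> \<le> 1 + 1"
      unfolding sum.distrib by (intro add_mono sum_half_powers_le sum_of_bool_eq_le_1) simp
    finally show ?thesis
      by simp
  qed
  then show ?case
    using integrable_deg_dev_sq by (intro integral_le_const) auto
next
  case (step n)
  have n: "n \<ge> 1"
    using step by simp
  note int = expectation_dev_incr[OF assms(1) n]
  have intS: "integrable M (\<lambda>\<omega>. \<Sum>k<K. (deg_dev n (Suc k) \<omega>)\<^sup>2)" for n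
    using integrable_deg_dev_sq by simp
  have intI: "integrable M (\<lambda>\<omega>. \<Sum>k<K. 2 * (deg_dev n (Suc k) \<omega> * incr n k \<omega>))"
    using int(1) by simp
  have intD: "integrable M (\<lambda>\<omega>. \<Sum>k<K. 2 * (deg_dev n (Suc k) \<omega> * drift n k \<omega>))"
    using int(2) by simp
  have "(\<integral>\<omega>. (\<Sum>k<K. (deg_dev (Suc n) (Suc k) \<omega>)\<^sup>2) \<partial>M)
      \<le> (\<integral>\<omega>. (\<Sum>k<K. (deg_dev n (Suc k) \<omega>)\<^sup>2)
          + (\<Sum>k<K. 2 * (deg_dev n (Suc k) \<omega> * incr n k \<omega>)) + 8 \<partial>M)"
  proof (rule integral_mono)
    fix \<omega> assume \<omega>: "\<omega> \<in> space M"
    have "(\<Sum>k<K. (deg_dev (Suc n) (Suc k) \<omega>)\<^sup>2) = (\<Sum>k<K. (deg_dev n (Suc k) \<omega>)\<^sup>2)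
        + (\<Sum>k<K. 2 * (deg_dev n (Suc k) \<omega> * incr n k \<omega>)) + (\<Sum>k<K. (incr n k \<omega>)\<^sup>2)"
      unfolding deg_dev_Suc[OF assms(1) n \<omega>] sum.distrib[symmetric]
      by (intro sum.cong refl) (simp add: power2_eq_square algebra_simps)
    then show "(\<Sum>k<K. (deg_dev (Suc n) (Suc k) \<omega>)\<^sup>2) \<le> (\<Sum>k<K. (deg_dev n (Suc k) \<omega>)\<^sup>2)
        + (\<Sum>k<K. 2 * (deg_dev n (Suc k) \<omega> * incr n k \<omega>)) + 8"
      using sum_incr_sq_le[OF n \<omega>, of K] by simp
  qed (use intS intI in auto)
  also have "\<dots> = (\<integral>\<omega>. (\<Sum>k<K. (deg_dev n (Suc k) \<omega>)\<^sup>2) \<partial>M)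
      + (\<integral>\<omega>. (\<Sum>k<K. 2 * (deg_dev n (Suc k) \<omega> * incr n k \<omega>)) \<partial>M) + 8"
    using intS intI by (simp add: prob_space del: Bochner_Integration.integral_sum)
  also have "(\<integral>\<omega>. (\<Sum>k<K. 2 * (deg_dev n (Suc k) \<omega> * incr n k \<omega>)) \<partial>M)
      = (\<integral>\<omega>. (\<Sum>k<K. 2 * (deg_dev n (Suc k) \<omega> * drift n k \<omega>)) \<partial>M)"
    using int by (simp add: Bochner_Integration.integral_sum)
  also have "\<dots> \<le> 24"
    using intD sum_dev_drift_le[OF assms(1) n] by (intro integral_le_const) auto
  finally show ?case
    using step.IH by simp
qed

text \<open>From 2 sqrt n |X| \<le> X^2 + n the second moment gives 16 sqrt n + sqrt n / 2.\<close>

lemma expectation_abs_dev_le: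
  assumes "m = 1" "n \<ge> 1" "k \<ge> 1"
  shows "(\<integral>\<omega>. \<bar>deg_dev n k \<omega>\<bar> \<partial>M) \<le> 17 * sqrt (real n)"
proof -
  have n: "sqrt (real n) > 0"
    using assms by simp
  have "(\<integral>\<omega>. \<bar>deg_dev n k \<omega>\<bar> \<partial>M)
      \<le> (\<integral>\<omega>. (\<Sum>l<k. (deg_dev n (Suc l) \<omega>)\<^sup>2) / (2 * sqrt (real n)) + sqrt (real n) / 2 \<partial>M)"
  proof (rule integral_mono)
    fix \<omega>
    have "(deg_dev n (Suc (k - 1)) \<omega>)\<^sup>2 \<le> (\<Sum>l<k. (deg_dev n (Suc l) \<omega>)\<^sup>2)"
      using assms by (intro member_le_sum) auto
    moreover have "0 \<le> (\<bar>deg_dev n k \<omega>\<bar> - sqrt (real n))\<^sup>2"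
      by simp
    ultimately have "2 * sqrt (real n) * \<bar>deg_dev n k \<omega>\<bar>
        \<le> (\<Sum>l<k. (deg_dev n (Suc l) \<omega>)\<^sup>2) + sqrt (real n) * sqrt (real n)"
      using assms by (simp add: power2_diff algebra_simps)
    then have "\<bar>deg_dev n k \<omega>\<bar>
        \<le> ((\<Sum>l<k. (deg_dev n (Suc l) \<omega>)\<^sup>2) + sqrt (real n) * sqrt (real n)) / (2 * sqrt (real n))"
      using n by (simp add: pos_le_divide_eq mult_ac)
    also have "\<dots> = (\<Sum>l<k. (deg_dev n (Suc l) \<omega>)\<^sup>2) / (2 * sqrt (real n)) + sqrt (real n) / 2"
      using n by (simp add: add_divide_distrib real_div_sqrt)
    finally show "\<bar>deg_dev n k \<omega>\<bar>
        \<le> (\<Sum>l<k. (deg_dev n (Suc l) \<omega>)\<^sup>2) / (2 * sqrt (real n)) + sqrt (real n) / 2" .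
  next
    show "integrable M (\<lambda>\<omega>. \<bar>deg_dev n k \<omega>\<bar>)"
      by (intro integrable_abs integrable_bounded[OF measurable_deg_dev abs_deg_dev_le])
  qed (use integrable_deg_dev_sq in simp)
  also have "\<dots> = (\<integral>\<omega>. (\<Sum>l<k. (deg_dev n (Suc l) \<omega>)\<^sup>2) \<partial>M) / (2 * sqrt (real n)) + sqrt (real n) / 2"
    using integrable_deg_dev_sq by (simp add: prob_space del: Bochner_Integration.integral_sum)
  also have "\<dots> \<le> 32 * real n / (2 * sqrt (real n)) + sqrt (real n) / 2"
    using n expectation_sum_dev_sq_le[OF assms(1,2), of k] by (intro add_right_mono divide_right_mono) auto
  also have "32 * real n / (2 * sqrt (real n)) = 16 * sqrt (real n)"
  proof -
    have "32 * real n / (2 * sqrt (real n)) = 16 * (real n / sqrt (real n))"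
      by simp
    then show ?thesis
      by (simp only: real_div_sqrt of_nat_0_le_iff)
  qed
  finally show ?thesis
    using n by linarith
qed

section \<open>Limits of the attachment probability and of the degree fractions\<close>

text \<open>The probability is the expectation of \<open>hit\<close>, hence of
  \<open>hit_prob\<close>, which is within 6/n of the fraction of vertices of degree k. That
  fraction differs from 2^(-k) by at most 17/sqrt n in mean.\<close>

theorem attachment_degree_limit:
  assumes "m = 1" "k \<ge> 1"
  shows "(\<lambda>n. measure M {\<omega> \<in> space M.
        \<exists>j\<in>{1..n}. T \<omega> (Suc n) 1 = j \<and> dpa_degree m (T \<omega>) n j = k}) \<longlonglongrightarrow> 1 / 2 ^ k"
proof (rule Lim_transform2[where f = "\<lambda>_. 1 / 2 ^ k"])
  define \<pi> where "\<pi> n = measure M {\<omega> \<in> space M.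
        \<exists>j\<in>{1..n}. T \<omega> (Suc n) 1 = j \<and> dpa_degree m (T \<omega>) n j = k}" for n
  have "\<bar>1 / 2 ^ k - \<pi> n\<bar> \<le> 17 / sqrt (real n) + 6 / real n" if n: "n \<ge> 1" for n
  proof -
    define A where "A = {\<omega> \<in> space M.
        \<exists>j\<in>{1..n}. T \<omega> (Suc n) 1 = j \<and> dpa_degree m (T \<omega>) n j = k}"
    have hit: "hit n k \<omega> = indicator A \<omega>" if "\<omega> \<in> space M" for \<omega>
    proof -
      have "T \<omega> (Suc n) 1 \<in> {1..n}"
        using T_range[of \<omega> "Suc n" 1] that n m_ge by auto
      moreover have "hit n k \<omega> = (\<Sum>j = 1..n. if T \<omega> (Suc n) 1 = j then of_bool (dpa_degree m (T \<omega>) n j = k) else 0)"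
        unfolding hit_def by (intro sum.cong) auto
      ultimately show ?thesis
        using that by (auto simp: A_def indicator_def)
    qed
    have inth: "integrable M (hit n k)"
      using hit_nonneg hit_le_1[OF n] by (intro integrable_bounded[where B = 1] measurable_hit n) auto
    have intp: "integrable M (hit_prob n k)"
      by (intro integrable_bounded[OF measurable_hit_prob hit_prob_bound] n assms)
    have intX: "integrable M (deg_dev n k)"
      by (rule integrable_bounded[OF measurable_deg_dev abs_deg_dev_le])
    have A: "A \<in> sets M"
    proof -
      have "A = {\<omega> \<in> space M. hit n k \<omega> = 1}"
        using hit by (auto simp: A_def indicator_def)
      also have "\<dots> \<in> sets M"
        using measurable_hit[OF n, of k] by simp
      finally show ?thesis .
    qed
    have "\<pi> n = (\<integral>\<omega>. indicator A \<omega> \<partial>M)"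
      using A by (simp add: \<pi>_def A_def)
    also have "\<dots> = (\<integral>\<omega>. hit n k \<omega> \<partial>M)"
      using hit by (intro Bochner_Integration.integral_cong) auto
    also have "\<dots> = (\<integral>\<omega>. hit_prob n k \<omega> \<partial>M)"
      using expectation_hit[OF n, of "\<lambda>_. 1" 1 k] by simp
    finally have "\<bar>1 / 2 ^ k - \<pi> n\<bar> = \<bar>\<integral>\<omega>. 1 / 2 ^ k - hit_prob n k \<omega> \<partial>M\<bar>"
      using intp by (simp add: prob_space)
    also have "\<dots> \<le> (\<integral>\<omega>. \<bar>deg_dev n k \<omega>\<bar> / real n + 6 / real n \<partial>M)"
    proof (rule order_trans[OF integral_abs_bound integral_mono])
      fix \<omega> assume \<omega>: "\<omega> \<in> space M"
      have "deg_dev n k \<omega> / real n = deg_count n k \<omega> / real n - 1 / 2 ^ k"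
        using assms(2) n by (simp add: deg_dev_def diff_divide_distrib)
      moreover have "\<bar>deg_dev n k \<omega> / real n\<bar> = \<bar>deg_dev n k \<omega>\<bar> / real n"
        by simp
      ultimately show "\<bar>1 / 2 ^ k - hit_prob n k \<omega>\<bar> \<le> \<bar>deg_dev n k \<omega>\<bar> / real n + 6 / real n"
        using hit_prob_approx[OF assms(1) n \<omega>, of k] by linarith
    qed (use intp intX in auto)
    also have "\<dots> = (\<integral>\<omega>. \<bar>deg_dev n k \<omega>\<bar> \<partial>M) / real n + 6 / real n"
      using intX by (simp add: prob_space)
    also have "\<dots> \<le> 17 * sqrt (real n) / real n + 6 / real n"
      using expectation_abs_dev_le[OF assms(1) n assms(2)] by (intro add_right_mono divide_right_mono) auto
    also have "17 * sqrt (real n) / real n = 17 / sqrt (real n)"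
      using n real_sqrt_mult_self[of "real n"] by (simp add: field_simps)
    finally show ?thesis .
  qed
  then have "\<forall>\<^sub>F n in sequentially. norm (1 / 2 ^ k - \<pi> n) \<le> 17 / sqrt (real n) + 6 / real n"
    by (intro eventually_sequentiallyI[of 1]) auto
  moreover have "(\<lambda>n. 17 / sqrt (real n) + 6 / real n) \<longlonglongrightarrow> 0"
    by real_asymp
  ultimately show "(\<lambda>n. 1 / 2 ^ k - measure M {\<omega> \<in> space M.
        \<exists>j\<in>{1..n}. T \<omega> (Suc n) 1 = j \<and> dpa_degree m (T \<omega>) n j = k}) \<longlonglongrightarrow> 0"
    unfolding \<pi>_def[symmetric] by (rule Lim_null_comparison)
qed simp

text \<open>The threshold is at least h = sqrt (log n / n). If the supremum exceeds it, some
  deviation exceeds n h, so the sum of squares is at least n log n. Its expectation is at most 32 n,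
  and Markov's inequality gives 32 / log n.\<close>

theorem degree_fraction_uniform:
  assumes "m = 1"
  shows "(\<lambda>n. measure M {\<omega> \<in> space M.
        (SUP k\<in>{1..}. \<bar>degree_fraction m (T \<omega>) n k - 1 / 2 ^ k\<bar>)
          > ln (real n) / real n + sqrt (ln (real n) / real n)}) \<longlonglongrightarrow> 0"
proof (rule Lim_null_comparison)
  \<comment> \<open>This disposes of the degrees above n, which no vertex attains: there the
    deviation is 2^(-k), below h.\<close>
  have "\<forall>\<^sub>F n in sequentially. 1 / 2 ^ n \<le> sqrt (ln (real n) / real n)"
    by real_asymp
  then show "\<forall>\<^sub>F n in sequentially. norm (measure M {\<omega> \<in> space M.
        (SUP k\<in>{1..}. \<bar>degree_fraction m (T \<omega>) n k - 1 / 2 ^ k\<bar>)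
          > ln (real n) / real n + sqrt (ln (real n) / real n)}) \<le> 32 / ln (real n)"
    using eventually_gt_at_top[of 1]
  proof eventually_elim
    case (elim n)
    define h where "h = sqrt (ln (real n) / real n)"
    have n: "n \<ge> 1" "real n > 0" "ln (real n) > 0"
      using elim(2) by auto
    have h: "h \<ge> 0" "h\<^sup>2 = ln (real n) / real n" "1 / 2 ^ n \<le> h"
      using n elim(1) by (simp_all add: h_def)
    have frac: "degree_fraction m (T \<omega>) n k - 1 / 2 ^ k = deg_dev n k \<omega> / real n" if "k \<ge> 1" for k \<omega>
      using that n by (simp add: degree_fraction_def deg_dev_def deg_count_def diff_divide_distrib)
    have large: "real n * ln (real n) \<le> (\<Sum>k<n. (deg_dev n (Suc k) \<omega>)\<^sup>2)"
      if "(SUP k\<in>{1..}. \<bar>degree_fraction m (T \<omega>) n k - 1 / 2 ^ k\<bar>) > ln (real n) / real n + h" for \<omega>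
    proof -
      have "\<exists>k\<ge>1. \<bar>deg_dev n k \<omega> / real n\<bar> > h"
      proof (rule ccontr)
        assume "\<not> ?thesis"
        then have "(SUP k\<in>{1..}. \<bar>degree_fraction m (T \<omega>) n k - 1 / 2 ^ k\<bar>) \<le> h"
          by (intro cSUP_least) (auto simp: frac not_less)
        moreover have "ln (real n) / real n \<ge> 0"
          using n by simp
        ultimately show False
          using that by linarith
      qed
      then obtain k where k: "k \<ge> 1" "\<bar>deg_dev n k \<omega> / real n\<bar> > h"
        by blast
      \<comment> \<open>Places the exceptional degree within the finite sum of squares that the
        second moment controls.\<close>
      have "k \<le> n"
      proof (rule ccontr)
        assume "\<not> k \<le> n"
        moreover have "dpa_degree m (T \<omega>) n j \<le> n" for j
          using dpa_degree_le[OF n(1), of m "T \<omega>" j] assms by simp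
        ultimately have "dpa_degree m (T \<omega>) n j \<noteq> k" for j
          by (metis)
        then have "\<bar>deg_dev n k \<omega> / real n\<bar> = 1 / 2 ^ k"
          using k n by (simp add: deg_dev_def deg_count_def)
        also have "\<dots> \<le> 1 / 2 ^ n"
          using \<open>\<not> k \<le> n\<close> by (intro divide_left_mono power_increasing) auto
        finally show False
          using k h by linarith
      qed
      have "h * real n \<le> \<bar>deg_dev n k \<omega>\<bar>"
        using k(2) n by (simp add: pos_less_divide_eq)
      then have "(h * real n)\<^sup>2 \<le> \<bar>deg_dev n k \<omega>\<bar>\<^sup>2"
        using h by (intro power_mono) auto
      also have "\<dots> = (deg_dev n (Suc (k - 1)) \<omega>)\<^sup>2"
        using k by simp
      also have "\<dots> \<le> (\<Sum>k<n. (deg_dev n (Suc k) \<omega>)\<^sup>2)"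
        using k \<open>k \<le> n\<close> by (intro member_le_sum) auto
      also have "(h * real n)\<^sup>2 = real n * ln (real n)"
        unfolding power_mult_distrib h(2) using n by (simp add: power2_eq_square)
      finally show ?thesis .
    qed
    have intS: "integrable M (\<lambda>\<omega>. \<Sum>k<n. (deg_dev n (Suc k) \<omega>)\<^sup>2)"
      using integrable_deg_dev_sq by simp
    have meas: "{\<omega> \<in> space M. (\<Sum>k<n. (deg_dev n (Suc k) \<omega>)\<^sup>2) \<ge> real n * ln (real n)} \<in> sets M"
      by measurable
    have "measure M {\<omega> \<in> space M. (SUP k\<in>{1..}. \<bar>degree_fraction m (T \<omega>) n k - 1 / 2 ^ k\<bar>)
          > ln (real n) / real n + sqrt (ln (real n) / real n)}
        \<le> measure M {\<omega> \<in> space M. (\<Sum>k<n. (deg_dev n (Suc k) \<omega>)\<^sup>2) \<ge> real n * ln (real n)}"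
      unfolding h_def[symmetric] using large by (intro finite_measure_mono meas) auto
    also have "\<dots> \<le> (\<integral>\<omega>. (\<Sum>k<n. (deg_dev n (Suc k) \<omega>)\<^sup>2) \<partial>M) / (real n * ln (real n))"
      using n by (intro integral_Markov_inequality_measure[OF intS sets.empty_sets]) (auto intro!: sum_nonneg)
    also have "\<dots> \<le> 32 * real n / (real n * ln (real n))"
      using expectation_sum_dev_sq_le[OF assms n(1), of n] n by (intro divide_right_mono) auto
    also have "\<dots> = 32 / ln (real n)"
      using n by simp
    finally show ?case
      by simp
  qed
  show "(\<lambda>n. 32 / ln (real n)) \<longlonglongrightarrow> 0"
    by real_asymp
qed

end

theorem theorem2p1:
  fixes M :: "'a measure" and \<alpha> \<theta> :: real and m i :: nat
    and T :: "'a \<Rightarrow> nat \<Rightarrow> nat \<Rightarrow> nat"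
  assumes "\<theta> \<ge> 1" and "0 < \<alpha>" and "\<alpha> \<le> 1" and "m \<ge> 1"
    and "linear_de_preferential_attachment M \<alpha> \<theta> m T"
    and "i \<ge> 1"
  shows
    "(\<forall>\<epsilon>>0. (\<lambda>n. measure M {\<omega> \<in> space M.
        \<bar>real (dpa_degree m (T \<omega>) n i) / (real m * ln (real n)) - 1\<bar> > \<epsilon>}) \<longlonglongrightarrow> 0)
     \<and> weak_conv_m
        (\<lambda>n. distr M borel (\<lambda>\<omega>.
          (real (dpa_degree m (T \<omega>) n i) - real m * ln (real n)) / sqrt (real m * ln (real n))))
        std_normal_distribution
     \<and> (m = 1 \<longrightarrow> (\<forall>k\<ge>1. (\<lambda>n. measure M {\<omega> \<in> space M.
        \<exists>j\<in>{1..n}. T \<omega> (Suc n) 1 = j \<and> dpa_degree m (T \<omega>) n j = k}) \<longlonglongrightarrow> 1 / 2 ^ k))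
     \<and> (m = 1 \<longrightarrow> (\<exists>C\<^sub>1>0. (\<lambda>n. measure M {\<omega> \<in> space M.
        (SUP k\<in>{1..}. \<bar>degree_fraction m (T \<omega>) n k - 1 / 2 ^ k\<bar>)
          > C\<^sub>1 * (ln (real n) / real n + sqrt (ln (real n) / real n))}) \<longlonglongrightarrow> 0))"
proof -
  interpret de_preferential_attachment M \<alpha> \<theta> m T
    using assms by (simp add: de_preferential_attachment_def de_preferential_attachment_axioms_def)
  \<comment> \<open>The constant of the last statement is 1.\<close>
  show ?thesis
    using degree_LLN degree_CLT attachment_degree_limit degree_fraction_uniform \<open>i \<ge> 1\<close>
    by (intro conjI impI allI exI[of _ "1 :: real"]) (simp_all only: zero_less_one mult_1_left)
qed

end
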